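(* Let $\nu>0$, $0<\theta<\theta_c$, and let $u_0\in H^5(\mathbb T^2)$ be real-valued with $\|u_0\|_\infty\le1-\delta_0$ for some $\delta_0\in(0,1)$. Let $\tau_0>0$ be the time step threshold described in the context, let $0<\tau\le\min\{\tau_0,\frac{\nu}{4\theta_c^2}\}$, and let $(u^n)_{n\ge0}$ be the solution of the scheme $$\frac{u^{n+1}-u^n}{\tau}=-\nu\Delta^2u^{n+1}-\theta_c\Delta u^{n+1}+\Delta\big(\tilde f(u^n)\big),\quad n\ge0,\qquad u^0=u_0 .$$ Let $u(t)$ be the exact global solution, described in the context, of $\partial_tu=\Delta(-\nu\Delta u-\theta_cu+\tilde f(u))$, $u|_{t=0}=u_0$. Define $t_m=m\tau$, $m\ge1$. Then for all $m\ge 1$, $$\|u(t_m)-u^m\|_2\le C_1e^{C_2t_m}\tau,$$ where $C_1,C_2>0$ depend on $(u_0,\delta_0,\nu,\theta_c,\theta)$.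
   Context: $\mathbb T^2=[-\pi,\pi)^2$ is the two-dimensional periodic torus; $\|\cdot\|_2$ and $\|\cdot\|_\infty$ are the $L^2(\mathbb T^2)$ and $L^\infty(\mathbb T^2)$ norms. For $z\in(-1,1)$, $\tilde f(z)=\frac{\theta}{2}\ln\frac{1+z}{1-z}$ and $F(z)=\frac{\theta}{2}\big((1+z)\ln(1+z)+(1-z)\ln(1-z)\big)-\frac{\theta_c}{2}z^2$; $\mathcal E(u)=\int_{\mathbb T^2}(\frac12\nu|\nabla u|^2+F(u))\,dx$. Numerical solution (established result of the paper): there are constants $\tau_0>0$, $A_1<\infty$, $\delta_1\in(0,1)$ depending only on $(\|u_0\|_{H^5},\delta_0,\nu,\theta,\theta_c)$ such that for every $0<\tau\le\tau_0$ the iterates $u^n$ of the scheme are well-defined for all $n\ge1$ (values in $(-1,1)$, and $u^{n+1}$ uniquely determined by $u^n$), $\sup_{n\ge1}\|u^n\|_{H^5}\le A_1$, $\sup_{n\ge1}\|u^n\|_\infty\le1-\delta_1$, and $\mathcal E(u^{n+1})\le\mathcal E(u^n)$ for all $n\ge0$. The $\tau_0$ in the claim is this one. Exact solution (established result of the paper): there is a unique global solution $u\in C^0([0,\infty);H^5(\mathbb T^2))\cap C^1([0,\infty);H^1(\mathbb T^2))$ of the equation satisfying $\sup_{t\ge0}\|u(t)\|_{H^5}<\infty$ and $\sup_{t\ge0}\|u(t)\|_\infty\le1-\delta_1'$ for some $\delta_1'\in(0,1)$. The $u$ in the claim is this one. *)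

theory Defs
  imports "HOL-Analysis.Analysis" "HOL-Probability.Essential_Supremum"
begin

text \<open>
  The torus is represented by its fundamental domain $[-\pi,\pi)^2$ with Lebesgue measure.  A
  function on the torus is a function on the plane of which only the values on this square matter,
  up to null sets; periodicity is enforced by the test functions defining weak derivatives.
\<close>

definition torus :: "(real \<times> real) measure" where
  "torus = restrict_space lborel ({-pi..<pi} \<times> {-pi..<pi})"

definition L2 :: "(real \<times> real \<Rightarrow> real) set" where
  "L2 = {f \<in> borel_measurable torus. integrable torus (\<lambda>x. (f x)\<^sup>2)}"

definition L2_norm :: "(real \<times> real \<Rightarrow> real) \<Rightarrow> real" where
  "L2_norm f = sqrt (\<integral>x. (f x)\<^sup>2 \<partial>torus)"

definition Linf_norm :: "(real \<times> real \<Rightarrow> real) \<Rightarrow> ereal" where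
  "Linf_norm f = esssup torus (\<lambda>x. ereal \<bar>f x\<bar>)"

definition pderiv1 :: "(real \<times> real \<Rightarrow> real) \<Rightarrow> real \<times> real \<Rightarrow> real" where
  "pderiv1 f = (\<lambda>(x, y). deriv (\<lambda>s. f (s, y)) x)"

definition pderiv2 :: "(real \<times> real \<Rightarrow> real) \<Rightarrow> real \<times> real \<Rightarrow> real" where
  "pderiv2 f = (\<lambda>(x, y). deriv (\<lambda>s. f (x, s)) y)"

definition pderivs :: "nat \<Rightarrow> nat \<Rightarrow> (real \<times> real \<Rightarrow> real) \<Rightarrow> real \<times> real \<Rightarrow> real" where
  "pderivs i j f = (pderiv1 ^^ i) ((pderiv2 ^^ j) f)"

text \<open>
  Test functions are the smooth functions on the plane that are $2\pi$-periodic in each variable.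
  Frechet differentiability of all the functions \<open>pderivs i j \<phi>\<close> makes them continuous, so the
  order of differentiation is immaterial and this is the usual notion of smoothness.
\<close>

definition test_function :: "(real \<times> real \<Rightarrow> real) \<Rightarrow> bool" where
  "test_function \<phi> \<longleftrightarrow>
     (\<forall>i j. pderivs i j \<phi> differentiable_on UNIV) \<and>
     (\<forall>x y. \<phi> (x + 2 * pi, y) = \<phi> (x, y) \<and> \<phi> (x, y + 2 * pi) = \<phi> (x, y))"

definition has_weak_deriv ::
    "nat \<Rightarrow> nat \<Rightarrow> (real \<times> real \<Rightarrow> real) \<Rightarrow> (real \<times> real \<Rightarrow> real) \<Rightarrow> bool" where
  "has_weak_deriv i j f g \<longleftrightarrow> f \<in> L2 \<and> g \<in> L2 \<and>
     (\<forall>\<phi>. test_function \<phi> \<longrightarrow>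
        (\<integral>x. f x * pderivs i j \<phi> x \<partial>torus) = (-1) ^ (i + j) * (\<integral>x. g x * \<phi> x \<partial>torus))"

text \<open>A representative of the weak derivative, which is unique up to null sets if it exists.\<close>

definition weak_deriv ::
    "nat \<Rightarrow> nat \<Rightarrow> (real \<times> real \<Rightarrow> real) \<Rightarrow> real \<times> real \<Rightarrow> real" where
  "weak_deriv i j f = (SOME g. has_weak_deriv i j f g)"

definition sobolev :: "nat \<Rightarrow> (real \<times> real \<Rightarrow> real) set" where
  "sobolev s = {f. \<forall>i j. i + j \<le> s \<longrightarrow> (\<exists>g. has_weak_deriv i j f g)}"

definition sobolev_norm :: "nat \<Rightarrow> (real \<times> real \<Rightarrow> real) \<Rightarrow> real" where
  "sobolev_norm s f = sqrt (\<Sum>(i, j)\<in>{(i, j). i + j \<le> s}. (L2_norm (weak_deriv i j f))\<^sup>2)"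

definition has_laplacian ::
    "(real \<times> real \<Rightarrow> real) \<Rightarrow> (real \<times> real \<Rightarrow> real) \<Rightarrow> bool" where
  "has_laplacian f g \<longleftrightarrow>
     (\<exists>a b. has_weak_deriv 2 0 f a \<and> has_weak_deriv 0 2 f b \<and> g = (\<lambda>x. a x + b x))"

text \<open>The functions \<open>f_tilde\<close> and \<open>potential\<close> are meaningful only for $z \in (-1,1)$.\<close>

definition f_tilde :: "real \<Rightarrow> real \<Rightarrow> real" where
  "f_tilde \<theta> z = \<theta> / 2 * ln ((1 + z) / (1 - z))"

definition potential :: "real \<Rightarrow> real \<Rightarrow> real \<Rightarrow> real" where
  "potential \<theta> \<theta>\<^sub>c z =
     \<theta> / 2 * ((1 + z) * ln (1 + z) + (1 - z) * ln (1 - z)) - \<theta>\<^sub>c / 2 * z\<^sup>2"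

definition energy :: "real \<Rightarrow> real \<Rightarrow> real \<Rightarrow> (real \<times> real \<Rightarrow> real) \<Rightarrow> real" where
  "energy \<nu> \<theta> \<theta>\<^sub>c u =
     (\<integral>x. \<nu> / 2 * ((weak_deriv 1 0 u x)\<^sup>2 + (weak_deriv 0 1 u x)\<^sup>2) + potential \<theta> \<theta>\<^sub>c (u x) \<partial>torus)"

text \<open>One step of the scheme: \<open>lap\<close>, \<open>bilap\<close>, \<open>nl\<close> stand for $\Delta w$, $\Delta^2 w$ and
  $\Delta(\tilde f(v))$.\<close>

definition scheme_step ::
    "real \<Rightarrow> real \<Rightarrow> real \<Rightarrow> real \<Rightarrow> (real \<times> real \<Rightarrow> real) \<Rightarrow> (real \<times> real \<Rightarrow> real) \<Rightarrow> bool" where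
  "scheme_step \<nu> \<theta> \<theta>\<^sub>c \<tau> v w \<longleftrightarrow>
     (\<exists>lap bilap nl. has_laplacian w lap \<and> has_laplacian lap bilap \<and>
        has_laplacian (\<lambda>x. f_tilde \<theta> (v x)) nl \<and>
        (AE x in torus. (w x - v x) / \<tau> = - \<nu> * bilap x - \<theta>\<^sub>c * lap x + nl x))"

definition scheme_solution ::
    "real \<Rightarrow> real \<Rightarrow> real \<Rightarrow> real \<Rightarrow> (real \<times> real \<Rightarrow> real) \<Rightarrow> (nat \<Rightarrow> real \<times> real \<Rightarrow> real) \<Rightarrow> bool" where
  "scheme_solution \<nu> \<theta> \<theta>\<^sub>c \<tau> u0 U \<longleftrightarrow>
     (AE x in torus. U 0 x = u0 x) \<and>
     (\<forall>n. U n \<in> L2 \<and> (AE x in torus. U n x \<in> {-1<..<1}) \<and>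
          scheme_step \<nu> \<theta> \<theta>\<^sub>c \<tau> (U n) (U (Suc n)))"

text \<open>
  \<open>time_step_threshold N \<delta>0 \<nu> \<theta> \<theta>\<^sub>c \<tau>0\<close>: for all time steps up to \<open>\<tau>0\<close> the scheme is well-posed,
  uniformly bounded and energy stable, with constants that are the same for all initial data of
  $H^5$-norm \<open>N\<close> and separation \<open>\<delta>0\<close> from the values $\pm 1$.
\<close>

definition time_step_threshold ::
    "real \<Rightarrow> real \<Rightarrow> real \<Rightarrow> real \<Rightarrow> real \<Rightarrow> real \<Rightarrow> bool" where
  "time_step_threshold N \<delta>0 \<nu> \<theta> \<theta>\<^sub>c \<tau>0 \<longleftrightarrow> 0 < \<tau>0 \<and>
     (\<exists>A1 \<delta>1. 0 < \<delta>1 \<and> \<delta>1 < 1 \<and>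
       (\<forall>v \<tau>. v \<in> sobolev 5 \<and> sobolev_norm 5 v = N \<and> Linf_norm v \<le> ereal (1 - \<delta>0) \<and>
              0 < \<tau> \<and> \<tau> \<le> \<tau>0 \<longrightarrow>
          (\<exists>V. scheme_solution \<nu> \<theta> \<theta>\<^sub>c \<tau> v V) \<and>
          (\<forall>V. scheme_solution \<nu> \<theta> \<theta>\<^sub>c \<tau> v V \<longrightarrow>
             (\<forall>n w. scheme_step \<nu> \<theta> \<theta>\<^sub>c \<tau> (V n) w \<longrightarrow> (AE x in torus. w x = V (Suc n) x)) \<and>
             (\<forall>n\<ge>1. V n \<in> sobolev 5 \<and> sobolev_norm 5 (V n) \<le> A1 \<and>
                     Linf_norm (V n) \<le> ereal (1 - \<delta>1)) \<and>
             (\<forall>n. energy \<nu> \<theta> \<theta>\<^sub>c (V (Suc n)) \<le> energy \<nu> \<theta> \<theta>\<^sub>c (V n)))))"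

definition sobolev_continuous :: "nat \<Rightarrow> (real \<Rightarrow> real \<times> real \<Rightarrow> real) \<Rightarrow> bool" where
  "sobolev_continuous s u \<longleftrightarrow> (\<forall>t\<ge>0. u t \<in> sobolev s \<and>
     ((\<lambda>r. sobolev_norm s (\<lambda>x. u r x - u t x)) \<longlongrightarrow> 0) (at t within {0..}))"

definition sobolev_has_time_deriv ::
    "nat \<Rightarrow> (real \<Rightarrow> real \<times> real \<Rightarrow> real) \<Rightarrow> (real \<Rightarrow> real \<times> real \<Rightarrow> real) \<Rightarrow> bool" where
  "sobolev_has_time_deriv s u ut \<longleftrightarrow> (\<forall>t\<ge>0.
     ((\<lambda>r. sobolev_norm s (\<lambda>x. (u r x - u t x) / (r - t) - ut t x)) \<longlongrightarrow> 0) (at t within {0..}))"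

text \<open>Below, \<open>ut\<close> is the time derivative of \<open>u\<close> and \<open>lap\<close> is $\Delta u(t)$.\<close>

definition exact_solution ::
    "real \<Rightarrow> real \<Rightarrow> real \<Rightarrow> (real \<times> real \<Rightarrow> real) \<Rightarrow> (real \<Rightarrow> real \<times> real \<Rightarrow> real) \<Rightarrow> bool" where
  "exact_solution \<nu> \<theta> \<theta>\<^sub>c u0 u \<longleftrightarrow>
     (AE x in torus. u 0 x = u0 x) \<and>
     sobolev_continuous 5 u \<and>
     (\<exists>B. \<forall>t\<ge>0. sobolev_norm 5 (u t) \<le> B) \<and>
     (\<exists>\<delta>. 0 < \<delta> \<and> \<delta> < 1 \<and> (\<forall>t\<ge>0. Linf_norm (u t) \<le> ereal (1 - \<delta>))) \<and>
     (\<exists>ut. sobolev_has_time_deriv 1 u ut \<and> sobolev_continuous 1 ut \<and>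
        (\<forall>t\<ge>0. \<exists>lap. has_laplacian (u t) lap \<and>
           has_laplacian (\<lambda>x. - \<nu> * lap x - \<theta>\<^sub>c * u t x + f_tilde \<theta> (u t x)) (ut t)))"

end

theory Submission imports Defs begin

text \<open>
  Functions in $L^2(\mathbb T^2)$ modulo null sets form a real inner product space in which
  trigonometric products are an orthogonal basis; weak Laplacians are Fourier multipliers there and hence
  symmetric.  Let $Y$ be the piecewise linear interpolation in time of the iterates and $e = u - Y$.
  On each step, testing the equation for $e$ with $e$ and moving the Laplacian onto $e$ gives
  \[ \tfrac{d}{dt}\|e\|_2^2 \le K \|e\|_2^2 + c\,(\|D_n\|_2^2 + \|\Delta D_n\|_2^2),
     \qquad D_n = u^{n+1} - u^n, \]
  because $\tilde f$ is Lipschitz on the range of the solutions.  The increments satisfy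
  $\|D_n\|_2^2 + \nu\tau\|\Delta D_n\|_2^2 \le e^{K\tau}\|D_{n-1}\|_2^2$ and
  $\|D_0\|_2^2 + \nu\tau\|\Delta D_0\|_2^2 \le 2\tau^2\|\partial_t u(0)\|_2^2$ (compare the first step
  with the equation at $t = 0$), so that a Gronwall argument yields $\|e\|_2 = O(\tau)$.
\<close>

section \<open>Orthogonal bases\<close>

text \<open>Weak derivatives are tested against smooth functions only, whereas the equation has to
  be tested with the error, which is merely known to have a weak Laplacian. Hence test functions
  serve only to read off Fourier coefficients, and density recovers the symmetry of the Laplacian.
  The expression under the outer Laplacian is kept whole, so no gradient and no derivative of the
  nonlinearity appears, and a Lipschitz bound in L2 suffices.

  In a single step the increment bound gives only ||\<Delta>D_n||^2 = O(\<tau>), one order too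
  little. Over all steps up to a fixed time \<tau> ||\<Delta>D_n||^2 sums to O(\<tau>^2), being the
  dissipation in a recursion for ||D_n||^2.

  A second obstacle is the order of quantifiers: the constants come before the threshold and the
  exact solution, although these furnish the separation from 1 and -1. One threshold and one exact
  solution are therefore selected; that another exact solution agrees with the selected one follows
  from the error estimate itself as the time step tends to zero.\<close>

locale orthogonal_basis =
  fixes \<phi> :: "'i \<Rightarrow> 'a::real_inner" and c :: real
  assumes c_pos: "0 < c"
    and inner_basis: "inner (\<phi> i) (\<phi> j) = (if i = j then c else 0)"
    and dense: "closure (span (range \<phi>)) = UNIV"
begin

definition proj :: "'i set \<Rightarrow> 'a \<Rightarrow> 'a" where
  "proj F h = (\<Sum>i\<in>F. (inner h (\<phi> i) / c) *\<^sub>R \<phi> i)"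

lemma inner_proj_residual:
  assumes "finite F" "i \<in> F"
  shows "inner (h - proj F h) (\<phi> i) = 0"
proof -
  have "inner (proj F h) (\<phi> i) = (\<Sum>j\<in>F. if j = i then inner h (\<phi> i) else 0)"
    unfolding proj_def inner_sum_left using c_pos
    by (intro sum.cong) (auto simp: inner_basis)
  with assms show ?thesis by (simp add: inner_diff_left)
qed

text \<open>Best approximation: the residual is orthogonal to the span, so its squared norm equals
  its inner product with \<open>h - p\<close>, and Cauchy-Schwarz cancels one factor.\<close>

lemma norm_proj_residual_le:
  assumes F: "finite F" and p: "p \<in> span (\<phi> ` F)"
  shows "norm (h - proj F h) \<le> norm (h - p)"
proof -
  have ort: "inner (h - proj F h) q = 0" if "q \<in> span (\<phi> ` F)" for q
    using that
  proof (induction rule: span_induct_alt)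
    case base then show ?case by simp
  next
    case (step a x y)
    then show ?case using inner_proj_residual[OF F] by (auto simp: inner_add_right)
  qed
  have "proj F h \<in> span (\<phi> ` F)"
    unfolding proj_def by (intro span_sum span_scale span_base) auto
  then have "inner (h - proj F h) (proj F h - p) = 0"
    using p by (intro ort span_diff)
  moreover have "inner (h - proj F h) (h - proj F h) + inner (h - proj F h) (proj F h - p)
      = inner (h - proj F h) (h - p)"
    by (simp add: inner_diff_right)
  ultimately have "(norm (h - proj F h))\<^sup>2 = inner (h - proj F h) (h - p)"
    by (simp add: power2_norm_eq_inner)
  also have "\<dots> \<le> norm (h - proj F h) * norm (h - p)"
    by (rule norm_cauchy_schwarz)
  finally show ?thesis
    unfolding power2_eq_square by (cases "h = proj F h") (auto dest: mult_left_le_imp_le)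
qed

text \<open>The bound persists for all larger finite index sets, so that two vectors can be
  approximated over one common set.\<close>

lemma proj_approx:
  assumes "0 < e"
  obtains F where "finite F" "\<And>F'. finite F' \<Longrightarrow> F \<subseteq> F' \<Longrightarrow> norm (h - proj F' h) < e"
proof -
  have "h \<in> closure (span (range \<phi>))" using dense by simp
  then obtain p where p: "p \<in> span (range \<phi>)" "dist p h < e"
    using assms by (meson closure_approachable)
  obtain F where F: "finite F" "p \<in> span (\<phi> ` F)"
  proof -
    obtain T r where T: "finite T" "T \<subseteq> range \<phi>" "p = (\<Sum>a\<in>T. r a *\<^sub>R a)"
      using p(1) unfolding span_explicit by blast
    then have "p \<in> span T" unfolding T(3) by (intro span_sum span_scale span_base)
    moreover obtain F where "finite F" "T = \<phi> ` F"
      using finite_subset_image[OF T(1,2)] by blast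
    ultimately show ?thesis using that by blast
  qed
  show ?thesis
  proof (rule that[OF F(1)])
    fix F' assume F': "finite F'" "F \<subseteq> F'"
    then have "p \<in> span (\<phi> ` F')" using F(2) span_mono[OF image_mono[OF F'(2), of \<phi>]] by blast
    from norm_proj_residual_le[OF F'(1) this, of h] p(2)
    show "norm (h - proj F' h) < e" by (simp add: dist_norm norm_minus_commute)
  qed
qed

lemma coefficients_zero_imp_zero:
  assumes "\<And>i. inner h (\<phi> i) = 0"
  shows "h = 0"
proof (rule ccontr)
  assume "h \<noteq> 0"
  then have "0 < norm h" by simp
  then obtain F where "finite F" and F: "\<And>F'. finite F' \<Longrightarrow> F \<subseteq> F' \<Longrightarrow> norm (h - proj F' h) < norm h"
    using proj_approx by metis
  then show False using F[of F] by (simp add: proj_def assms)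
qed

text \<open>The multiplier \<open>m\<close> may be unbounded, so \<open>g\<close> and
  \<open>g'\<close> are never approximated: only \<open>f\<close> and \<open>f'\<close> are replaced
  by projections, and the limit is taken in the other factor of each inner product.\<close>

lemma inner_eq_of_multiplier:
  assumes g: "\<And>i. inner g (\<phi> i) = m i * inner f (\<phi> i)"
    and g': "\<And>i. inner g' (\<phi> i) = m i * inner f' (\<phi> i)"
  shows "inner g f' = inner f g'"
proof -
  have "\<bar>inner g f' - inner f g'\<bar> \<le> e" if "0 < e" for e
  proof -
    define e' where "e' = e / (norm g + norm g' + 1)"
    have pos: "0 < norm g + norm g' + 1" by (simp add: add_nonneg_pos)
    have "0 < e'" using that pos by (simp add: e'_def)
    obtain F1 where F1: "finite F1" "\<And>F'. finite F' \<Longrightarrow> F1 \<subseteq> F' \<Longrightarrow> norm (f - proj F' f) < e'"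
      using proj_approx[OF \<open>0 < e'\<close>] by metis
    obtain F2 where F2: "finite F2" "\<And>F'. finite F' \<Longrightarrow> F2 \<subseteq> F' \<Longrightarrow> norm (f' - proj F' f') < e'"
      using proj_approx[OF \<open>0 < e'\<close>] by metis
    define F where "F = F1 \<union> F2"
    have r: "norm (f - proj F f) < e'" "norm (f' - proj F f') < e'"
      using F1 F2 by (auto simp: F_def)
    \<comment> \<open>Both sides are the sum over \<open>F\<close> of \<open>m i\<close> times the
      coefficients of \<open>f\<close> and \<open>f'\<close>, divided by \<open>c\<close>.\<close>
    have "inner g (proj F f') = inner (proj F f) g'"
      unfolding proj_def inner_sum_left inner_sum_right
      by (intro sum.cong) (simp_all add: g g' inner_commute[of "\<phi> _" g'])
    then have "inner g f' - inner f g' = inner g (f' - proj F f') - inner (f - proj F f) g'"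
      by (simp add: inner_diff_left inner_diff_right)
    then have "\<bar>inner g f' - inner f g'\<bar> \<le> norm g * norm (f' - proj F f') + norm (f - proj F f) * norm g'"
      using Cauchy_Schwarz_ineq2[of g "f' - proj F f'"] Cauchy_Schwarz_ineq2[of "f - proj F f" g']
      by linarith
    also have "\<dots> \<le> norm g * e' + e' * norm g'"
      using r \<open>0 < e'\<close> by (intro add_mono mult_mono) auto
    also have "\<dots> \<le> (norm g + norm g' + 1) * e'"
      using \<open>0 < e'\<close> by (simp add: algebra_simps)
    also have "\<dots> = e" using pos by (simp add: e'_def)
    finally show ?thesis .
  qed
  then have "\<bar>inner g f' - inner f g'\<bar> \<le> 0"
    by (rule field_le_epsilon) simp
  then show ?thesis by simp
qed

end

section \<open>The error estimate for an abstract symmetric operator\<close>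

lemma young_weighted:
  fixes x y s :: real
  assumes "0 < s"
  shows "x * y \<le> s * x\<^sup>2 + y\<^sup>2 / (4 * s)"
proof -
  have "0 \<le> (2 * s * x - y)\<^sup>2 / (4 * s)" using assms by simp
  also have "\<dots> = s * x\<^sup>2 + y\<^sup>2 / (4 * s) - x * y"
    using assms by (simp add: power2_eq_square field_simps)
  finally show ?thesis by simp
qed

text \<open>\<open>E\<close> times the integrating factor, minus \<open>b * s\<close>, is
  nonincreasing, because the factor is at most 1 and may be dropped next to \<open>b\<close>. The
  bound is linear in \<open>b\<close> and avoids division by \<open>K\<close>, which may be
  0.\<close>

lemma gronwall_linear:
  fixes E E' :: "real \<Rightarrow> real"
  assumes "0 \<le> T" "0 \<le> K" "0 \<le> b"
    and der: "\<And>s. 0 \<le> s \<Longrightarrow> s \<le> T \<Longrightarrow> (E has_real_derivative E' s) (at s within {0..T})"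
    and le: "\<And>s. 0 \<le> s \<Longrightarrow> s \<le> T \<Longrightarrow> E' s \<le> K * E s + b"
  shows "E T \<le> exp (K * T) * (E 0 + T * b)"
proof -
  define h where "h s = E s * exp (- K * s) - b * s" for s
  have hd: "(h has_real_derivative (E' s - K * E s) * exp (- K * s) - b) (at s within {0..T})"
    if "0 \<le> s" "s \<le> T" for s
    unfolding h_def by (auto intro!: derivative_eq_intros der that simp: algebra_simps)
  have "h T \<le> h 0"
  proof (rule DERIV_nonpos_imp_decreasing_open[where f = h])
    show "\<exists>y. DERIV h s :> y \<and> y \<le> 0" if "0 < s" "s < T" for s
    proof (intro exI conjI)
      have "at s within {0..T} = at s" using that by (intro at_within_interior) auto
      then show "DERIV h s :> (E' s - K * E s) * exp (- K * s) - b" using hd[of s] that by simp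
      have "(E' s - K * E s) * exp (- K * s) \<le> b * exp (- K * s)"
        using le[of s] that by (intro mult_right_mono) auto
      also have "\<dots> \<le> b * 1" using that assms by (intro mult_left_mono) auto
      finally show "(E' s - K * E s) * exp (- K * s) - b \<le> 0" by simp
    qed
    show "continuous_on {0..T} h"
      unfolding continuous_on_eq_continuous_within
      using hd DERIV_continuous by (metis atLeastAtMost_iff)
  qed (use assms in auto)
  then have "E T * exp (- K * T) \<le> E 0 + T * b" by (simp add: h_def algebra_simps)
  from mult_left_mono[OF this, of "exp (K * T)"] show ?thesis
    by (simp add: exp_minus field_simps)
qed

lemma discrete_error_growth:
  fixes E a d :: "nat \<Rightarrow> real"
  assumes pos: "0 < \<nu>" "0 < \<tau>" "0 \<le> K"
    and nn: "\<And>n. 0 \<le> E n" "\<And>n. 0 \<le> a n" "\<And>n. 0 \<le> d n"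
    and E0: "E 0 = 0"
    and E: "\<And>n. E (Suc n) \<le> exp (K * \<tau>) * (E n + \<tau> * (K * a n + 3 * \<nu> / 2 * d n))"
    and a: "\<And>n. a (Suc n) + \<nu> * \<tau> * d (Suc n) \<le> exp (K * \<tau>) * a n"
    and a0: "a 0 + \<nu> * \<tau> * d 0 \<le> S"
  shows "E (Suc m) \<le> 3 / 2 * exp (2 * K * (real (Suc m) * \<tau>)) * S"
proof -
  define q where "q = exp (K * \<tau>)"
  have q: "1 \<le> q" "1 + K * \<tau> \<le> q" "0 < q" using pos by (auto simp: q_def)
  define G where "G n = E (Suc n) + 3 / 2 * q * a n" for n
  \<comment> \<open>Adding a multiple of \<open>a\<close> to \<open>E\<close> lets the dissipation in the bound for \<open>a\<close> absorb the term with \<open>d\<close>.\<close>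
  have step: "G n \<le> q * (E n + \<tau> * K * a n + 3 / 2 * (a n + \<nu> * \<tau> * d n))" for n
    using E[of n] by (simp add: G_def q_def algebra_simps)
  have "G m \<le> 3 / 2 * (q\<^sup>2) ^ (Suc m) * S"
  proof (induction m)
    case 0
    have "0 \<le> \<nu> * \<tau> * d 0" using pos nn by simp
    then have "\<tau> * K * a 0 \<le> \<tau> * K * (a 0 + \<nu> * \<tau> * d 0) * (3 / 2)"
      using pos nn mult_nonneg_nonneg[of "\<tau> * K" "\<nu> * \<tau> * d 0"] mult_nonneg_nonneg[of "\<tau> * K" "a 0"]
      by (simp add: distrib_left)
    then have "\<tau> * K * a 0 + 3 / 2 * (a 0 + \<nu> * \<tau> * d 0) \<le> 3 / 2 * (1 + K * \<tau>) * (a 0 + \<nu> * \<tau> * d 0)"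
      by (simp add: algebra_simps)
    also have "\<dots> \<le> 3 / 2 * q * S"
      using q pos a0 \<open>0 \<le> \<nu> * \<tau> * d 0\<close> nn(2)[of 0] by (intro mult_mono) auto
    finally have "q * (E 0 + \<tau> * K * a 0 + 3 / 2 * (a 0 + \<nu> * \<tau> * d 0)) \<le> q * (3 / 2 * q * S)"
      using q E0 by (intro mult_left_mono) auto
    from order_trans[OF step[of 0] this] show ?case by (simp add: power2_eq_square mult_ac)
  next
    case (Suc m)
    have "0 \<le> q * a m" using q nn by simp
    have "0 \<le> \<nu> * \<tau> * d (Suc m)" using pos nn by simp
    then have "a (Suc m) \<le> G m"
      using a[of m] nn(1)[of "Suc m"] \<open>0 \<le> q * a m\<close> by (simp add: G_def q_def[symmetric])
    then have "\<tau> * K * a (Suc m) \<le> \<tau> * K * G m" using pos by (intro mult_left_mono) auto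
    moreover have "E (Suc m) + 3 / 2 * (a (Suc m) + \<nu> * \<tau> * d (Suc m)) \<le> G m"
      using a[of m] by (simp add: G_def q_def[symmetric])
    ultimately have "E (Suc m) + \<tau> * K * a (Suc m) + 3 / 2 * (a (Suc m) + \<nu> * \<tau> * d (Suc m)) \<le> (1 + K * \<tau>) * G m"
      by (simp add: algebra_simps)
    \<comment> \<open>Each step costs two factors \<open>q\<close>: this one absorbs the term
      \<open>\<tau> * K * a (Suc m)\<close>, the other comes from the bound on \<open>E\<close>.
      This is the origin of \<open>2 * K\<close> in the exponent.\<close>
    also have "\<dots> \<le> q * G m" using q nn by (intro mult_right_mono) (auto simp: G_def)
    finally have "G (Suc m) \<le> q * (q * G m)"
      using step[of "Suc m"] q by (meson mult_left_mono order_trans less_imp_le)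
    also have "\<dots> \<le> q * (q * (3 / 2 * (q\<^sup>2) ^ (Suc m) * S))"
      using Suc q by (intro mult_left_mono) auto
    finally show ?case by (simp add: power2_eq_square mult_ac)
  qed
  moreover have "(q\<^sup>2) ^ (Suc m) = exp (2 * K * (real (Suc m) * \<tau>))"
  proof -
    have "q\<^sup>2 = exp (2 * (K * \<tau>))" by (simp add: q_def exp_double)
    then show ?thesis by (simp only: exp_of_nat_mult[symmetric]) (simp only: mult_ac)
  qed
  ultimately have "G m \<le> 3 / 2 * exp (2 * K * (real (Suc m) * \<tau>)) * S" by simp
  moreover have "0 \<le> q * a m" using q nn(2)[of m] by simp
  ultimately show ?thesis unfolding G_def by linarith
qed

text \<open>\<open>A\<close> is the graph of an unbounded operator; writing it as a relation lets
  \<open>A f g\<close> express at once that \<open>f\<close> lies in the domain and that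
  \<open>g\<close> is its image.\<close>

locale symmetric_operator =
  fixes A :: "'a::real_inner \<Rightarrow> 'a \<Rightarrow> bool"
  assumes sym: "A f g \<Longrightarrow> A f' g' \<Longrightarrow> inner g f' = inner f g'"
    and add: "A f g \<Longrightarrow> A f' g' \<Longrightarrow> A (f + f') (g + g')"
    and scale: "A f g \<Longrightarrow> A (r *\<^sub>R f) (r *\<^sub>R g)"
begin

lemma diff: "A f g \<Longrightarrow> A f' g' \<Longrightarrow> A (f - f') (g - g')"
  using add[of f g "- f'" "- g'"] scale[of f' g' "-1"] by simp

text \<open>\<open>D0\<close> and \<open>D\<close> are consecutive increments, and \<open>eq\<close>
  is the difference of two successive scheme equations. Testing with \<open>D\<close> leaves two
  cross terms with \<open>LD\<close>; each takes a quarter of the dissipation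
  \<open>\<nu> * d\<close>, so that half of it survives, and multiplication by
  \<open>2 * \<tau>\<close> produces the term in the claim.\<close>

lemma increment_energy:
  assumes pos: "0 < \<nu>" "0 < \<tau>" and \<tau>: "\<tau> \<le> \<nu> / (4 * \<kappa>\<^sup>2)"
    and D: "A D LD"
    and eq: "A ((- \<nu>) *\<^sub>R LD - \<kappa> *\<^sub>R D + G) ((1 / \<tau>) *\<^sub>R (D - D0))"
    and G: "norm G \<le> L * norm D0"
  shows "(norm D)\<^sup>2 + \<nu> * \<tau> * (norm LD)\<^sup>2
    \<le> exp ((4 * \<kappa>\<^sup>2 / \<nu> + 2 * L\<^sup>2 / \<nu>) * \<tau>) * (norm D0)\<^sup>2"
proof -
  define a where "a = (norm D)\<^sup>2"
  define a0 where "a0 = (norm D0)\<^sup>2"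
  define d where "d = (norm LD)\<^sup>2"
  define x where "x = \<tau> * 2 * \<kappa>\<^sup>2 / \<nu>"
  have nn: "0 \<le> a" "0 \<le> a0" "0 \<le> d" "0 \<le> x" using pos by (auto simp: a_def a0_def d_def x_def)
  have x: "x \<le> 1 / 2" using \<tau> pos unfolding x_def
    by (cases "\<kappa> = 0") (auto simp: field_simps)
  have i1: "(1 / \<tau>) * inner (D - D0) D = inner ((- \<nu>) *\<^sub>R LD - \<kappa> *\<^sub>R D + G) LD"
    using sym[OF eq D] by simp
  have i2: "inner (D - D0) D \<ge> (a - a0) / 2"
  proof -
    have "0 \<le> (norm (D - D0))\<^sup>2" by simp
    then have "2 * inner D D0 \<le> a + a0"
      by (simp add: power2_norm_eq_inner inner_diff_left inner_diff_right inner_commute a_def a0_def)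
    then show ?thesis
      by (simp add: inner_diff_left inner_commute[of D0 D] power2_norm_eq_inner a_def field_simps)
  qed
  have "- \<kappa> * inner D LD \<le> norm LD * (\<bar>\<kappa>\<bar> * norm D)"
    using mult_left_mono[OF Cauchy_Schwarz_ineq2[of D LD], of "\<bar>\<kappa>\<bar>"]
      abs_ge_minus_self[of "\<kappa> * inner D LD"]
    by (simp add: abs_mult mult_ac)
  also have "\<dots> \<le> \<nu> / 4 * d + \<kappa>\<^sup>2 / \<nu> * a"
    using young_weighted[of "\<nu> / 4" "norm LD" "\<bar>\<kappa>\<bar> * norm D"] pos
    by (simp add: power_mult_distrib d_def a_def)
  finally have i3: "- \<kappa> * inner D LD \<le> \<nu> / 4 * d + \<kappa>\<^sup>2 / \<nu> * a" .
  have "inner G LD \<le> norm G * norm LD" by (rule norm_cauchy_schwarz)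
  also have "\<dots> \<le> norm LD * (L * norm D0)" using mult_right_mono[OF G norm_ge_zero[of LD]] by (simp add: mult_ac)
  also have "\<dots> \<le> \<nu> / 4 * d + L\<^sup>2 / \<nu> * a0"
    using young_weighted[of "\<nu> / 4" "norm LD" "L * norm D0"] pos
    by (simp add: power_mult_distrib d_def a0_def)
  finally have i4: "inner G LD \<le> \<nu> / 4 * d + L\<^sup>2 / \<nu> * a0" .
  have "inner ((- \<nu>) *\<^sub>R LD - \<kappa> *\<^sub>R D + G) LD = - \<nu> * d - \<kappa> * inner D LD + inner G LD"
    by (simp add: inner_add_left inner_diff_left power2_norm_eq_inner d_def)
  also have "\<dots> \<le> - (\<nu> / 2) * d + \<kappa>\<^sup>2 / \<nu> * a + L\<^sup>2 / \<nu> * a0"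
    using i3 i4 by linarith
  finally have "(1 / \<tau>) * ((a - a0) / 2) \<le> - (\<nu> / 2) * d + \<kappa>\<^sup>2 / \<nu> * a + L\<^sup>2 / \<nu> * a0"
    using i1 mult_left_mono[OF i2, of "1 / \<tau>"] pos by simp
  from mult_left_mono[OF this, of "2 * \<tau>"]
  have "2 * \<tau> * ((1 / \<tau>) * ((a - a0) / 2)) \<le> 2 * \<tau> * (- (\<nu> / 2) * d + \<kappa>\<^sup>2 / \<nu> * a + L\<^sup>2 / \<nu> * a0)"
    using pos by simp
  moreover have "2 * \<tau> * ((1 / \<tau>) * ((a - a0) / 2)) = a - a0" using pos by simp
  moreover have "2 * \<tau> * (- (\<nu> / 2) * d + \<kappa>\<^sup>2 / \<nu> * a + L\<^sup>2 / \<nu> * a0)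
      = - \<nu> * \<tau> * d + x * a + 2 * L\<^sup>2 / \<nu> * \<tau> * a0"
    using pos by (simp add: x_def field_simps)
  ultimately have main: "a - a0 \<le> - \<nu> * \<tau> * d + x * a + 2 * L\<^sup>2 / \<nu> * \<tau> * a0" by simp
  define y where "y = 2 * L\<^sup>2 / \<nu> * \<tau>"
  have y: "0 \<le> y" using pos by (simp add: y_def)
  have "(1 - x) * (a + \<nu> * \<tau> * d) \<le> (1 + y) * a0"
  proof -
    have "0 \<le> x * (\<nu> * \<tau> * d)" using nn pos by simp
    with main show ?thesis by (simp add: y_def algebra_simps)
  qed
  also have "\<dots> \<le> exp y * a0" using nn by (intro mult_right_mono) auto
  finally have "a + \<nu> * \<tau> * d \<le> exp y * a0 / (1 - x)"
    using x by (simp add: pos_le_divide_eq mult.commute)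
  also have "\<dots> = exp y * a0 * (1 / (1 - x))" by simp
  \<comment> \<open>The restriction on the time step enters here: it gives
    \<open>x \<le> 1 / 2\<close>, where \<open>1 / (1 - x)\<close> is dominated by an
    exponential.\<close>
  also have "\<dots> \<le> exp y * a0 * exp (2 * x)"
  proof (intro mult_left_mono)
    have "1 \<le> (1 + 2 * x) * (1 - x)" using mult_nonneg_nonneg[of x "1 - 2 * x"] x nn
      by (simp add: algebra_simps)
    also have "\<dots> \<le> exp (2 * x) * (1 - x)" using x by (intro mult_right_mono) auto
    finally show "1 / (1 - x) \<le> exp (2 * x)" using x by (simp add: pos_divide_le_eq)
  qed (use nn in auto)
  also have "\<dots> = exp ((4 * \<kappa>\<^sup>2 / \<nu> + 2 * L\<^sup>2 / \<nu>) * \<tau>) * a0"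
    by (simp add: x_def y_def algebra_simps exp_add)
  finally show ?thesis by (simp add: a_def a0_def d_def)
qed

text \<open>Here \<open>v\<close> is the time derivative of the exact solution at time 0. The
  nonlinear terms have cancelled, since scheme and equation start from the same datum, and
  \<open>v\<close> is the only source left; it makes the first increment of order \<tau>.\<close>

lemma first_increment_energy:
  assumes pos: "0 < \<nu>" "0 < \<tau>" and \<tau>: "\<tau> \<le> \<nu> / (4 * \<kappa>\<^sup>2)"
    and D: "A D LD"
    and eq: "A ((- \<nu>) *\<^sub>R LD - \<kappa> *\<^sub>R D) ((1 / \<tau>) *\<^sub>R D - v)"
  shows "(norm D)\<^sup>2 + \<nu> * \<tau> * (norm LD)\<^sup>2 \<le> 2 * \<tau>\<^sup>2 * (norm v)\<^sup>2"
proof -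
  define a where "a = (norm D)\<^sup>2"
  define d where "d = (norm LD)\<^sup>2"
  have nn: "0 \<le> a" "0 \<le> d" by (auto simp: a_def d_def)
  have k: "\<tau> * \<kappa>\<^sup>2 / \<nu> \<le> 1 / 4" using \<tau> pos
    by (cases "\<kappa> = 0") (auto simp: field_simps)
  have i1: "(1 / \<tau>) * a - inner v D = - \<nu> * d - \<kappa> * inner D LD"
    using sym[OF eq D] by (simp add: inner_diff_left power2_norm_eq_inner a_def d_def)
  have "- \<kappa> * inner D LD \<le> norm LD * (\<bar>\<kappa>\<bar> * norm D)"
    using mult_left_mono[OF Cauchy_Schwarz_ineq2[of D LD], of "\<bar>\<kappa>\<bar>"]
      abs_ge_minus_self[of "\<kappa> * inner D LD"]
    by (simp add: abs_mult mult_ac)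
  also have "\<dots> \<le> \<nu> / 2 * d + \<kappa>\<^sup>2 / \<nu> * a / 2"
    using young_weighted[of "\<nu> / 2" "norm LD" "\<bar>\<kappa>\<bar> * norm D"] pos
    by (simp add: power_mult_distrib d_def a_def)
  finally have i3: "- \<kappa> * inner D LD \<le> \<nu> / 2 * d + \<kappa>\<^sup>2 / \<nu> * a / 2" .
  have "\<tau> * inner v D \<le> norm D * (\<tau> * norm v)"
    using norm_cauchy_schwarz[of v D] pos by (simp add: mult_ac)
  also have "\<dots> \<le> a / 4 + \<tau>\<^sup>2 * (norm v)\<^sup>2"
    using young_weighted[of "1 / 4" "norm D" "\<tau> * norm v"] by (simp add: power_mult_distrib a_def)
  finally have i4: "\<tau> * inner v D \<le> a / 4 + \<tau>\<^sup>2 * (norm v)\<^sup>2" .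
  have "a = \<tau> * inner v D + \<tau> * (- \<nu> * d - \<kappa> * inner D LD)"
    using i1 pos by (simp add: field_simps)
  also have "\<dots> \<le> a / 4 + \<tau>\<^sup>2 * (norm v)\<^sup>2 + \<tau> * (- (\<nu> / 2) * d + \<kappa>\<^sup>2 / \<nu> * a / 2)"
    using i4 i3 pos by (intro add_mono mult_left_mono) auto
  also have "\<dots> = a / 4 + \<tau>\<^sup>2 * (norm v)\<^sup>2 - \<nu> * \<tau> * d / 2 + (\<tau> * \<kappa>\<^sup>2 / \<nu>) * a / 2"
    by (simp add: algebra_simps)
  also have "\<dots> \<le> a / 4 + \<tau>\<^sup>2 * (norm v)\<^sup>2 - \<nu> * \<tau> * d / 2 + (1 / 4) * a / 2"
    using mult_right_mono[OF k nn(1)] by (simp add: mult_ac)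
  finally have "a + \<nu> * \<tau> * d \<le> 2 * (\<tau>\<^sup>2 * (norm v)\<^sup>2)" using nn by linarith
  then show ?thesis by (simp add: a_def d_def mult.assoc)
qed

text \<open>Energy estimate for the difference of \<open>v\<close> and the linear interpolation of \<open>U0\<close> and \<open>U1\<close>.\<close>

lemma one_step_error:
  assumes pos: "0 < \<nu>" "0 < \<tau>" "0 \<le> \<kappa>" "0 \<le> L"
    and v: "\<And>s. 0 \<le> s \<Longrightarrow> s \<le> \<tau> \<Longrightarrow> (v has_vector_derivative v' s) (at s within {0..\<tau>})"
    and Lv: "\<And>s. 0 \<le> s \<Longrightarrow> s \<le> \<tau> \<Longrightarrow> A (v s) (Lv s)"
    and eqv: "\<And>s. 0 \<le> s \<Longrightarrow> s \<le> \<tau> \<Longrightarrow> A ((- \<nu>) *\<^sub>R Lv s - \<kappa> *\<^sub>R v s + fv s) (v' s)"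
    and LU0: "A U0 LU0" and LU1: "A U1 LU1"
    and eqU: "A ((- \<nu>) *\<^sub>R LU1 - \<kappa> *\<^sub>R U1 + F0) ((1 / \<tau>) *\<^sub>R (U1 - U0))"
    and lip: "\<And>s. 0 \<le> s \<Longrightarrow> s \<le> \<tau> \<Longrightarrow> norm (fv s - F0) \<le> L * norm (v s - U0)"
  defines "K \<equiv> 3 * (\<kappa> + L)\<^sup>2 / (2 * \<nu>)"
  shows "(norm (v \<tau> - U1))\<^sup>2 \<le> exp (K * \<tau>) *
    ((norm (v 0 - U0))\<^sup>2 + \<tau> * (K * (norm (U1 - U0))\<^sup>2 + 3 * \<nu> / 2 * (norm (LU1 - LU0))\<^sup>2))"
proof -
  define D where "D = U1 - U0"
  define LD where "LD = LU1 - LU0"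
  define e where "e s = v s - (U0 + (s / \<tau>) *\<^sub>R D)" for s
  define e' where "e' s = v' s - (1 / \<tau>) *\<^sub>R D" for s
  define Le where "Le s = Lv s - (LU0 + (s / \<tau>) *\<^sub>R LD)" for s
  define b where "b = K * (norm D)\<^sup>2 + 3 * \<nu> / 2 * (norm LD)\<^sup>2"
  have K: "0 \<le> K" using pos by (simp add: K_def)
  have b: "0 \<le> b" using K pos by (simp add: b_def)
  have der: "((\<lambda>s. inner (e s) (e s)) has_real_derivative 2 * inner (e' s) (e s)) (at s within {0..\<tau>})"
    if s: "0 \<le> s" "s \<le> \<tau>" for s
  proof -
    have "(e has_vector_derivative e' s) (at s within {0..\<tau>})"
      unfolding e_def e'_def by (auto intro!: derivative_eq_intros v s simp: divide_inverse)
    from bounded_bilinear.has_vector_derivative[OF bounded_bilinear_inner this this]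
    show ?thesis
      by (simp add: has_real_derivative_iff_has_vector_derivative inner_commute)
  qed
  have bound: "2 * inner (e' s) (e s) \<le> K * inner (e s) (e s) + b" if s: "0 \<le> s" "s \<le> \<tau>" for s
  proof -
    \<comment> \<open>The linear terms of the scheme are evaluated at the endpoint
      \<open>U1\<close>, which differs from the interpolation at time \<open>s\<close> by
      \<open>\<rho> *\<^sub>R D\<close>. This mismatch, the lower order term in \<open>e s\<close>
      and the defect of the nonlinearity make up \<open>R\<close>.\<close>
    define \<rho> where "\<rho> = 1 - s / \<tau>"
    have \<rho>: "0 \<le> \<rho>" "\<rho> \<le> 1" using s pos by (auto simp: \<rho>_def field_simps)
    define R where "R = (\<nu> * \<rho>) *\<^sub>R LD - \<kappa> *\<^sub>R e s + (\<kappa> * \<rho>) *\<^sub>R D + (fv s - F0)"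
    have Q: "((- \<nu>) *\<^sub>R Lv s - \<kappa> *\<^sub>R v s + fv s) - ((- \<nu>) *\<^sub>R LU1 - \<kappa> *\<^sub>R U1 + F0)
        = (- \<nu>) *\<^sub>R Le s + R"
    proof -
      have 1: "Lv s - LU1 = Le s - \<rho> *\<^sub>R LD" "v s - U1 = e s - \<rho> *\<^sub>R D"
        by (simp_all add: Le_def e_def \<rho>_def D_def LD_def algebra_simps)
      have "((- \<nu>) *\<^sub>R Lv s - \<kappa> *\<^sub>R v s + fv s) - ((- \<nu>) *\<^sub>R LU1 - \<kappa> *\<^sub>R U1 + F0)
          = (- \<nu>) *\<^sub>R (Lv s - LU1) - \<kappa> *\<^sub>R (v s - U1) + (fv s - F0)"
        by (simp add: algebra_simps)
      then show ?thesis unfolding 1 R_def by (simp add: algebra_simps)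
    qed
    have "A (e s) (Le s)"
      unfolding e_def Le_def D_def LD_def by (intro diff add scale Lv s LU0 LU1)
    moreover have "A ((- \<nu>) *\<^sub>R Le s + R) (e' s)"
      using diff[OF eqv[OF s] eqU] unfolding Q e'_def D_def .
    ultimately have "inner (e' s) (e s) = inner ((- \<nu>) *\<^sub>R Le s + R) (Le s)"
      using sym by blast
    also have "\<dots> = - \<nu> * (norm (Le s))\<^sup>2 + inner R (Le s)"
      by (simp add: inner_add_left inner_diff_left power2_norm_eq_inner)
    also have "\<dots> \<le> - \<nu> * (norm (Le s))\<^sup>2 + norm (Le s) * norm R"
      using norm_cauchy_schwarz[of R "Le s"] by (simp add: mult.commute)
    \<comment> \<open>The whole dissipation of the error is spent on \<open>R\<close>, which
      contains no \<open>Le s\<close>.\<close>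
    also have "\<dots> \<le> (norm R)\<^sup>2 / (4 * \<nu>)"
      using young_weighted[OF pos(1), of "norm (Le s)" "norm R"] by simp
    finally have i1: "2 * inner (e' s) (e s) \<le> (norm R)\<^sup>2 / (2 * \<nu>)" by (simp add: field_simps)
    \<comment> \<open>The contributions to \<open>R\<close> are grouped by \<open>LD\<close>,
      \<open>e s\<close> and \<open>D\<close>. The square of a sum of three terms costs the factor 3
      seen in \<open>K\<close> and in \<open>3 * \<nu> / 2\<close>.\<close>
    define X where "X = \<nu> * norm LD"
    define Y where "Y = (\<kappa> + L) * norm (e s)"
    define Z where "Z = (\<kappa> + L) * norm D"
    have "norm (v s - U0) \<le> norm (e s) + norm D"
    proof -
      have "v s - U0 = e s + (s / \<tau>) *\<^sub>R D" by (simp add: e_def)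
      then have "norm (v s - U0) \<le> norm (e s) + norm ((s / \<tau>) *\<^sub>R D)"
        by (simp only: norm_triangle_ineq)
      also have "norm ((s / \<tau>) *\<^sub>R D) \<le> norm D"
        using s pos mult_right_mono[of "s / \<tau>" 1 "norm D"] by simp
      finally show ?thesis by simp
    qed
    then have F: "norm (fv s - F0) \<le> L * norm (e s) + L * norm D"
      using lip[OF s] mult_left_mono[of _ _ L] pos(4) by (fastforce simp: distrib_left)
    have "norm R \<le> norm ((\<nu> * \<rho>) *\<^sub>R LD) + norm (\<kappa> *\<^sub>R e s) + norm ((\<kappa> * \<rho>) *\<^sub>R D) + norm (fv s - F0)"
      unfolding R_def by (meson add_mono norm_triangle_le norm_triangle_le_diff order_refl)
    also have "\<dots> \<le> \<nu> * norm LD + \<kappa> * norm (e s) + \<kappa> * norm D + (L * norm (e s) + L * norm D)"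
    proof (intro add_mono F)
      show "norm ((\<nu> * \<rho>) *\<^sub>R LD) \<le> \<nu> * norm LD" "norm ((\<kappa> * \<rho>) *\<^sub>R D) \<le> \<kappa> * norm D"
        using pos \<rho> by (auto simp: mult.assoc mult_left_le_one_le intro!: mult_left_mono)
      show "norm (\<kappa> *\<^sub>R e s) \<le> \<kappa> * norm (e s)" using pos by simp
    qed
    also have "\<dots> = X + Y + Z" by (simp add: X_def Y_def Z_def algebra_simps)
    finally have "(norm R)\<^sup>2 \<le> (X + Y + Z)\<^sup>2" by (intro power_mono) auto
    also have "\<dots> \<le> 3 * (X\<^sup>2 + Y\<^sup>2 + Z\<^sup>2)"
      using sum_squares_ge_zero[of "X - Y" "Y - Z"] zero_le_square[of "X - Z"]
      by (simp add: power2_eq_square algebra_simps)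
    finally have "(norm R)\<^sup>2 / (2 * \<nu>) \<le> 3 * (X\<^sup>2 + Y\<^sup>2 + Z\<^sup>2) / (2 * \<nu>)"
      using pos by (intro divide_right_mono) auto
    moreover have "X\<^sup>2 = \<nu>\<^sup>2 * (norm LD)\<^sup>2" "Y\<^sup>2 = (\<kappa> + L)\<^sup>2 * inner (e s) (e s)"
      "Z\<^sup>2 = (\<kappa> + L)\<^sup>2 * (norm D)\<^sup>2"
      by (simp_all only: X_def Y_def Z_def power_mult_distrib power2_norm_eq_inner)
    moreover have "3 * (\<nu>\<^sup>2 * (norm LD)\<^sup>2 + (\<kappa> + L)\<^sup>2 * inner (e s) (e s) + (\<kappa> + L)\<^sup>2 * (norm D)\<^sup>2) / (2 * \<nu>)
        = K * inner (e s) (e s) + b"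
      using pos by (simp add: K_def b_def field_simps power2_eq_square[of \<nu>])
    ultimately show ?thesis using i1 by simp
  qed
  have "inner (e \<tau>) (e \<tau>) \<le> exp (K * \<tau>) * (inner (e 0) (e 0) + \<tau> * b)"
    using pos K b der bound by (intro gronwall_linear[where E' = "\<lambda>s. 2 * inner (e' s) (e s)"]) auto
  then show ?thesis using pos
    by (simp add: e_def b_def D_def LD_def power2_norm_eq_inner)
qed

theorem scheme_error:
  assumes pos: "0 < \<nu>" "0 < \<tau>" "0 \<le> \<kappa>" "0 \<le> L" and \<tau>: "\<tau> \<le> \<nu> / (4 * \<kappa>\<^sup>2)"
    and u: "\<And>t. 0 \<le> t \<Longrightarrow> (u has_vector_derivative u' t) (at t within {0..})"
    and Lu: "\<And>t. 0 \<le> t \<Longrightarrow> A (u t) (Lu t)"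
    and equ: "\<And>t. 0 \<le> t \<Longrightarrow> A ((- \<nu>) *\<^sub>R Lu t - \<kappa> *\<^sub>R u t + fu t) (u' t)"
    and U0: "U 0 = u 0" and LU0: "LU 0 = Lu 0"
    and LU: "\<And>n. A (U n) (LU n)"
    and eqU: "\<And>n. A ((- \<nu>) *\<^sub>R LU (Suc n) - \<kappa> *\<^sub>R U (Suc n) + F n) ((1 / \<tau>) *\<^sub>R (U (Suc n) - U n))"
    and lip: "\<And>t n. 0 \<le> t \<Longrightarrow> norm (fu t - F n) \<le> L * norm (u t - U n)"
    and lipU: "\<And>n. norm (F (Suc n) - F n) \<le> L * norm (U (Suc n) - U n)"
  defines "K \<equiv> 3 * (\<kappa> + L)\<^sup>2 / (2 * \<nu>) + (4 * \<kappa>\<^sup>2 / \<nu> + 2 * L\<^sup>2 / \<nu>)"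
  shows "norm (u (real (Suc m) * \<tau>) - U (Suc m)) \<le> 2 * norm (u' 0) * exp (K * (real (Suc m) * \<tau>)) * \<tau>"
proof -
  define E where "E n = (norm (u (real n * \<tau>) - U n))\<^sup>2" for n
  define a where "a n = (norm (U (Suc n) - U n))\<^sup>2" for n
  define d where "d n = (norm (LU (Suc n) - LU n))\<^sup>2" for n
  \<comment> \<open>\<open>K0\<close> is the growth rate of the interpolation error and
    \<open>K1\<close> that of the increments. Their sum dominates both, so one rate can serve in
    both recursions.\<close>
  define K0 where "K0 = 3 * (\<kappa> + L)\<^sup>2 / (2 * \<nu>)"
  define K1 where "K1 = 4 * \<kappa>\<^sup>2 / \<nu> + 2 * L\<^sup>2 / \<nu>"
  have K: "0 \<le> K0" "0 \<le> K1" "K = K0 + K1"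
    using pos by (auto simp: K0_def K1_def K_def)
  \<comment> \<open>At time 0 the Lipschitz bound has right-hand side 0. This equality cancels the
    nonlinear terms in the estimate of the first increment.\<close>
  have F0: "F 0 = fu 0" using lip[of 0 0] U0 by simp
  have "E (Suc m) \<le> 3 / 2 * exp (2 * K * (real (Suc m) * \<tau>)) * (2 * \<tau>\<^sup>2 * (norm (u' 0))\<^sup>2)"
  proof (rule discrete_error_growth[where \<nu> = \<nu> and a = a and d = d])
    show "0 < \<nu>" "0 < \<tau>" "0 \<le> K" using pos K by auto
    show "0 \<le> E n" "0 \<le> a n" "0 \<le> d n" for n by (auto simp: E_def a_def d_def)
    show "E 0 = 0" using U0 by (simp add: E_def)
    show "E (Suc n) \<le> exp (K * \<tau>) * (E n + \<tau> * (K * a n + 3 * \<nu> / 2 * d n))" for n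
    proof -
      define t where "t = real n * \<tau>"
      have t: "0 \<le> t" using pos by (simp add: t_def)
      have "(norm (u (t + \<tau>) - U (Suc n)))\<^sup>2 \<le> exp (K0 * \<tau>) * ((norm (u (t + 0) - U n))\<^sup>2 + \<tau> * (K0 * a n + 3 * \<nu> / 2 * d n))"
        unfolding K0_def a_def d_def
      proof (rule one_step_error[where v = "\<lambda>s. u (t + s)" and v' = "\<lambda>s. u' (t + s)" and Lv = "\<lambda>s. Lu (t + s)"
            and fv = "\<lambda>s. fu (t + s)", OF pos _ _ _ LU LU eqU])
        fix s assume s: "0 \<le> s" "s \<le> \<tau>"
        show "((\<lambda>s. u (t + s)) has_vector_derivative u' (t + s)) (at s within {0..\<tau>})"
        proof -
          have 1: "(u has_vector_derivative u' (t + s)) (at (t + s) within (\<lambda>s. t + s) ` {0..\<tau>})"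
            using t s by (intro has_vector_derivative_within_subset[OF u]) auto
          have 2: "((\<lambda>s. t + s) has_vector_derivative 1) (at s within {0..\<tau>})"
            by (auto intro!: derivative_eq_intros)
          from vector_diff_chain_within[OF 2 1] show ?thesis by (simp add: o_def)
        qed
        show "A (u (t + s)) (Lu (t + s))"
          "A ((- \<nu>) *\<^sub>R Lu (t + s) - \<kappa> *\<^sub>R u (t + s) + fu (t + s)) (u' (t + s))"
          "norm (fu (t + s) - F n) \<le> L * norm (u (t + s) - U n)"
          using Lu equ lip s t by auto
      qed
      then have "E (Suc n) \<le> exp (K0 * \<tau>) * (E n + \<tau> * (K0 * a n + 3 * \<nu> / 2 * d n))"
        by (simp add: E_def t_def algebra_simps)
      also have "\<dots> \<le> exp (K * \<tau>) * (E n + \<tau> * (K * a n + 3 * \<nu> / 2 * d n))"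
        using K pos by (intro mult_mono add_mono mult_left_mono mult_right_mono)
          (auto simp: E_def a_def d_def intro!: mult_right_mono)
      finally show ?thesis .
    qed
    show "a (Suc n) + \<nu> * \<tau> * d (Suc n) \<le> exp (K * \<tau>) * a n" for n
    proof -
      have "a (Suc n) + \<nu> * \<tau> * d (Suc n) \<le> exp (K1 * \<tau>) * a n"
        unfolding a_def d_def K1_def
      proof (rule increment_energy[OF pos(1,2) \<tau> diff[OF LU LU] _ lipU])
        have "((- \<nu>) *\<^sub>R LU (Suc (Suc n)) - \<kappa> *\<^sub>R U (Suc (Suc n)) + F (Suc n)) -
            ((- \<nu>) *\<^sub>R LU (Suc n) - \<kappa> *\<^sub>R U (Suc n) + F n)
          = (- \<nu>) *\<^sub>R (LU (Suc (Suc n)) - LU (Suc n)) - \<kappa> *\<^sub>R (U (Suc (Suc n)) - U (Suc n)) + (F (Suc n) - F n)"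
          by (simp add: algebra_simps)
        with diff[OF eqU[of "Suc n"] eqU[of n]]
        show "A ((- \<nu>) *\<^sub>R (LU (Suc (Suc n)) - LU (Suc n)) - \<kappa> *\<^sub>R (U (Suc (Suc n)) - U (Suc n)) + (F (Suc n) - F n))
          ((1 / \<tau>) *\<^sub>R (U (Suc (Suc n)) - U (Suc n) - (U (Suc n) - U n)))"
          by (simp only: scaleR_diff_right)
      qed
      also have "\<dots> \<le> exp (K * \<tau>) * a n"
        using K pos by (intro mult_right_mono) (auto simp: a_def)
      finally show ?thesis .
    qed
    show "a 0 + \<nu> * \<tau> * d 0 \<le> 2 * \<tau>\<^sup>2 * (norm (u' 0))\<^sup>2"
      unfolding a_def d_def
    proof (rule first_increment_energy[OF pos(1,2) \<tau> diff[OF LU LU]])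
      have "A ((- \<nu>) *\<^sub>R LU 0 - \<kappa> *\<^sub>R U 0 + F 0) (u' 0)"
        using equ[of 0] by (simp add: U0 LU0 F0)
      from diff[OF eqU[of 0] this]
      show "A ((- \<nu>) *\<^sub>R (LU (Suc 0) - LU 0) - \<kappa> *\<^sub>R (U (Suc 0) - U 0))
        ((1 / \<tau>) *\<^sub>R (U (Suc 0) - U 0) - u' 0)"
        by (simp add: algebra_simps)
    qed
  qed
  also have "exp (2 * K * (real (Suc m) * \<tau>)) = (exp (K * (real (Suc m) * \<tau>)))\<^sup>2"
    by (simp only: exp_double[symmetric] mult.assoc)
  also have "3 / 2 * (exp (K * (real (Suc m) * \<tau>)))\<^sup>2 * (2 * \<tau>\<^sup>2 * (norm (u' 0))\<^sup>2)
      = 3 * (norm (u' 0) * exp (K * (real (Suc m) * \<tau>)) * \<tau>)\<^sup>2"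
    by (simp only: power_mult_distrib) (simp add: mult_ac)
  \<comment> \<open>The constant 2 in the claim is an upper bound for the square root of 3.\<close>
  also have "\<dots> \<le> (2 * norm (u' 0) * exp (K * (real (Suc m) * \<tau>)) * \<tau>)\<^sup>2"
    by (simp only: power_mult_distrib mult.assoc) (simp add: mult_right_mono)
  finally show ?thesis
    unfolding E_def by (rule power2_le_imp_le) (use pos in auto)
qed

end

section \<open>Square-integrable functions on the torus modulo null sets\<close>

lemma space_torus: "space torus = {-pi..<pi} \<times> {-pi..<pi}"
  by (simp add: torus_def space_restrict_space)

lemma torus_square_borel: "{-pi..<pi} \<times> {-pi..<pi} \<in> sets (borel :: (real \<times> real) measure)"
  unfolding borel_prod[symmetric] by (rule pair_measureI) auto

lemma emeasure_torus: "emeasure torus (space torus) = ennreal (4 * pi\<^sup>2)"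
proof -
  have "emeasure torus (space torus) = emeasure lborel ({-pi..<pi} \<times> {-pi..<pi} :: (real \<times> real) set)"
    unfolding space_torus using torus_square_borel
    by (subst torus_def, subst emeasure_restrict_space) auto
  also have "\<dots> = emeasure (lborel \<Otimes>\<^sub>M lborel) ({-pi..<pi} \<times> {-pi..<pi} :: (real \<times> real) set)"
    by (simp add: lborel_prod)
  also have "\<dots> = ennreal (2 * pi) * ennreal (2 * pi)"
    by (subst lborel.emeasure_pair_measure_Times) auto
  also have "\<dots> = ennreal (4 * pi\<^sup>2)"
    by (simp add: power2_eq_square flip: ennreal_mult)
  finally show ?thesis .
qed

interpretation torus: finite_measure torus
  by standard (simp add: emeasure_torus)

lemma borel_measurable_torus [measurable_dest]:
  "f \<in> borel_measurable borel \<Longrightarrow> f \<in> borel_measurable torus"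
  unfolding torus_def by (rule measurable_restrict_space1) simp

lemma L2_measurable: "f \<in> L2 \<Longrightarrow> f \<in> borel_measurable torus"
  by (simp add: L2_def)

lemma L2_mult_integrable:
  assumes "f \<in> L2" "g \<in> L2"
  shows "integrable torus (\<lambda>x. f x * g x)"
proof (rule Bochner_Integration.integrable_bound)
  show "integrable torus (\<lambda>x. (f x)\<^sup>2 + (g x)\<^sup>2)"
    using assms by (simp add: L2_def)
  show "(\<lambda>x. f x * g x) \<in> borel_measurable torus"
    using assms by (auto simp: L2_def)
  show "AE x in torus. norm (f x * g x) \<le> norm ((f x)\<^sup>2 + (g x)\<^sup>2)"
  proof (rule AE_I2)
    fix x
    have "0 \<le> \<bar>f x\<bar> * \<bar>g x\<bar>" by simp
    then have "\<bar>f x\<bar> * \<bar>g x\<bar> \<le> (f x)\<^sup>2 + (g x)\<^sup>2"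
      using sum_squares_bound[of "\<bar>f x\<bar>" "\<bar>g x\<bar>"] unfolding power2_abs by linarith
    then show "norm (f x * g x) \<le> norm ((f x)\<^sup>2 + (g x)\<^sup>2)" by (simp add: abs_mult)
  qed
qed

lemma L2_add: "f \<in> L2 \<Longrightarrow> g \<in> L2 \<Longrightarrow> (\<lambda>x. f x + g x) \<in> L2"
  using L2_mult_integrable[of f g] by (auto simp: L2_def power2_sum mult.assoc)

lemma L2_scale: "f \<in> L2 \<Longrightarrow> (\<lambda>x. r * f x) \<in> L2"
  by (auto simp: L2_def power_mult_distrib)

lemma L2_uminus: "f \<in> L2 \<Longrightarrow> (\<lambda>x. - f x) \<in> L2"
  by (auto simp: L2_def)

lemma L2_diff: "f \<in> L2 \<Longrightarrow> g \<in> L2 \<Longrightarrow> (\<lambda>x. f x - g x) \<in> L2"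
  using L2_add[of f "\<lambda>x. - g x"] L2_uminus[of g] by simp

lemma L2_bounded:
  assumes "f \<in> borel_measurable torus" "AE x in torus. \<bar>f x\<bar> \<le> B"
  shows "f \<in> L2"
proof -
  have "AE x in torus. norm ((f x)\<^sup>2) \<le> B\<^sup>2"
    using assms(2)
  proof eventually_elim
    case (elim x)
    then have "\<bar>f x\<bar>\<^sup>2 \<le> B\<^sup>2" by (intro power_mono) auto
    then show ?case by simp
  qed
  then show ?thesis
    using assms(1) by (auto simp: L2_def intro!: torus.integrable_const_bound[of _ "B\<^sup>2"])
qed

lemma L2_const: "(\<lambda>_. c) \<in> L2"
  by (rule L2_bounded[of _ "\<bar>c\<bar>"]) auto

\<comment> \<open>The relation is reflexive exactly on \<open>L2\<close>, hence a partial quotient.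
  Passing to classes makes the inner product definite, so that the abstract estimates apply to a
  type of class \<open>real_inner\<close>.\<close>
quotient_type l2 = "real \<times> real \<Rightarrow> real" / partial: "\<lambda>f g. f \<in> L2 \<and> g \<in> L2 \<and> (AE x in torus. f x = g x)"
proof (rule part_equivpI)
  show "\<exists>f. f \<in> L2 \<and> f \<in> L2 \<and> (AE x in torus. f x = f x)"
    using L2_const[of 0] by auto
  show "symp (\<lambda>f g. f \<in> L2 \<and> g \<in> L2 \<and> (AE x in torus. f x = g x))"
    by (auto simp: symp_def eq_commute)
  show "transp (\<lambda>f g. f \<in> L2 \<and> g \<in> L2 \<and> (AE x in torus. f x = g x))"
    by (auto simp: transp_def elim: eventually_elim2)
qed

instantiation l2 :: real_inner
begin

lift_definition zero_l2 :: l2 is "\<lambda>_. 0" by (simp add: L2_const)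

lift_definition plus_l2 :: "l2 \<Rightarrow> l2 \<Rightarrow> l2" is "\<lambda>f g x. f x + g x"
  by (auto intro: L2_add)

lift_definition minus_l2 :: "l2 \<Rightarrow> l2 \<Rightarrow> l2" is "\<lambda>f g x. f x - g x"
  by (auto intro: L2_diff)

lift_definition uminus_l2 :: "l2 \<Rightarrow> l2" is "\<lambda>f x. - f x"
  by (auto intro: L2_uminus)

lift_definition scaleR_l2 :: "real \<Rightarrow> l2 \<Rightarrow> l2" is "\<lambda>r f x. r * f x"
  by (auto intro: L2_scale)

lift_definition inner_l2 :: "l2 \<Rightarrow> l2 \<Rightarrow> real" is "\<lambda>f g. \<integral>x. f x * g x \<partial>torus"
  by (intro integral_cong_AE) (auto intro!: borel_measurable_times dest: L2_measurable)

definition norm_l2 :: "l2 \<Rightarrow> real" where "norm_l2 f = sqrt (inner f f)"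

definition sgn_l2 :: "l2 \<Rightarrow> l2" where "sgn_l2 f = inverse (norm f) *\<^sub>R f"

definition dist_l2 :: "l2 \<Rightarrow> l2 \<Rightarrow> real" where "dist_l2 f g = norm (f - g)"

definition uniformity_l2 :: "(l2 \<times> l2) filter" where
  "uniformity_l2 = (INF e\<in>{0<..}. principal {(x, y). dist x y < e})"

definition open_l2 :: "l2 set \<Rightarrow> bool" where
  "open_l2 U \<longleftrightarrow> (\<forall>x\<in>U. eventually (\<lambda>(x', y). x' = x \<longrightarrow> y \<in> U) uniformity)"

instance
proof
  fix f g h :: l2 and r s :: real
  show "f + g + h = f + (g + h)" by transfer (auto intro: L2_add simp: add.assoc)
  show "f + g = g + f" by transfer (auto intro: L2_add simp: add.commute)
  show "0 + f = f" by transfer auto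
  show "- f + f = 0" by transfer (auto intro: L2_const)
  show "f - g = f + - g" by transfer (auto intro: L2_diff)
  show "r *\<^sub>R (f + g) = r *\<^sub>R f + r *\<^sub>R g"
    by transfer (auto intro: L2_add L2_scale simp: distrib_left)
  show "(r + s) *\<^sub>R f = r *\<^sub>R f + s *\<^sub>R f"
    by transfer (auto intro: L2_add L2_scale simp: distrib_right)
  show "r *\<^sub>R s *\<^sub>R f = (r * s) *\<^sub>R f" by transfer (auto intro: L2_scale simp: mult.assoc)
  show "1 *\<^sub>R f = f" by transfer auto
  show "inner f g = inner g f" by transfer (simp add: mult.commute)
  show "inner (f + g) h = inner f h + inner g h"
    by transfer (auto simp: distrib_right L2_mult_integrable)
  show "inner (r *\<^sub>R f) g = r * inner f g" by transfer (simp add: mult.assoc)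
  show "0 \<le> inner f f" by transfer simp
  show "inner f f = 0 \<longleftrightarrow> f = 0"
  proof transfer
    fix f :: "real \<times> real \<Rightarrow> real"
    assume f: "f \<in> L2 \<and> f \<in> L2 \<and> (AE x in torus. f x = f x)"
    have "(\<integral>x. f x * f x \<partial>torus) = 0 \<longleftrightarrow> (AE x in torus. f x * f x = 0)"
      using f by (intro integral_nonneg_eq_0_iff_AE L2_mult_integrable) auto
    then show "(\<integral>x. f x * f x \<partial>torus) = 0 \<longleftrightarrow> f \<in> L2 \<and> (\<lambda>_. 0) \<in> L2 \<and> (AE x in torus. f x = 0)"
      using f L2_const[of 0] by simp
  qed
qed (simp_all add: norm_l2_def sgn_l2_def dist_l2_def uniformity_l2_def open_l2_def)

end

lemma abs_l2_eq_iff: "f \<in> L2 \<Longrightarrow> g \<in> L2 \<Longrightarrow> abs_l2 f = abs_l2 g \<longleftrightarrow> (AE x in torus. f x = g x)"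
  using Quotient3_rel[OF Quotient3_l2, of f g] by auto

lemma abs_l2_plus: "f \<in> L2 \<Longrightarrow> g \<in> L2 \<Longrightarrow> abs_l2 f + abs_l2 g = abs_l2 (\<lambda>x. f x + g x)"
  by (simp add: plus_l2.abs_eq eq_onp_def)

lemma abs_l2_minus: "f \<in> L2 \<Longrightarrow> g \<in> L2 \<Longrightarrow> abs_l2 f - abs_l2 g = abs_l2 (\<lambda>x. f x - g x)"
  by (simp add: minus_l2.abs_eq eq_onp_def)

lemma abs_l2_scaleR: "f \<in> L2 \<Longrightarrow> r *\<^sub>R abs_l2 f = abs_l2 (\<lambda>x. r * f x)"
  by (simp add: scaleR_l2.abs_eq eq_onp_def)

lemma inner_abs_l2: "f \<in> L2 \<Longrightarrow> g \<in> L2 \<Longrightarrow> inner (abs_l2 f) (abs_l2 g) = (\<integral>x. f x * g x \<partial>torus)"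
  by (simp add: inner_l2.abs_eq eq_onp_def)

lemma norm_abs_l2: "f \<in> L2 \<Longrightarrow> norm (abs_l2 f) = L2_norm f"
  by (simp add: norm_l2_def L2_norm_def inner_abs_l2 power2_eq_square)

lemma abs_l2_cases:
  obtains f where "f \<in> L2" "h = abs_l2 f"
  by (induct h rule: l2.abs_induct) auto

section \<open>Trigonometric polynomials\<close>

text \<open>
  The products $\mathrm{cas}(kx)\,\mathrm{cas}(ly)$ form a real orthogonal basis indexed by all
  integer pairs, with a single product formula in place of the four for sines and cosines.
\<close>

definition cas :: "real \<Rightarrow> real" where "cas t = cos t + sin t"

text \<open>The right-hand side is linear in \<open>cas\<close> and keeps integer frequencies
  integer. The formula thus closes trigonometric polynomials under products and reduces
  orthogonality to integrals of a single \<open>cas\<close>.\<close>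

lemma cas_mult: "cas s * cas t = 1 / 2 * (cas (s - t) + cas (t - s) + cas (s + t) - cas (- (s + t)))"
  by (simp add: cas_def cos_add cos_diff sin_add sin_diff algebra_simps)

lemma cos_eq_cas: "cos t = 1 / 2 * (cas t + cas (- t))" and sin_eq_cas: "sin t = 1 / 2 * (cas t - cas (- t))"
  by (simp_all add: cas_def)

lemma abs_cas_le: "\<bar>cas t\<bar> \<le> 2"
  using abs_cos_le_one[of t] abs_sin_le_one[of t] unfolding cas_def by linarith

lemma cas_has_derivative: "((\<lambda>x. cas (k * x)) has_real_derivative k * cas (- (k * x))) (at x within S)"
  unfolding cas_def by (auto intro!: derivative_eq_intros simp: algebra_simps)

definition hartley :: "int \<times> int \<Rightarrow> real \<times> real \<Rightarrow> real" where
  "hartley k z = cas (of_int (fst k) * fst z) * cas (of_int (snd k) * snd z)"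

text \<open>The span is described at the level of functions, because Stone-Weierstrass needs
  products and multiplication is not an operation on \<open>l2\<close>.\<close>

inductive trig_poly :: "(real \<times> real \<Rightarrow> real) \<Rightarrow> bool" where
  basis: "trig_poly (hartley k)"
| add: "trig_poly f \<Longrightarrow> trig_poly g \<Longrightarrow> trig_poly (\<lambda>z. f z + g z)"
| scale: "trig_poly f \<Longrightarrow> trig_poly (\<lambda>z. r * f z)"

lemma trig_poly_diff: "trig_poly f \<Longrightarrow> trig_poly g \<Longrightarrow> trig_poly (\<lambda>z. f z - g z)"
  using trig_poly.add[of f "\<lambda>z. - 1 * g z"] trig_poly.scale[of g "- 1"] by simp

lemma hartley_mult_trig_poly: "trig_poly (\<lambda>z. hartley (a, b) z * hartley (c, d) z)"
proof -
  define H where "H p q = hartley (p, q)" for p q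
  have "hartley (a, b) z * hartley (c, d) z =
      1 / 4 * (H (a - c) (b - d) z + H (a - c) (d - b) z + H (a - c) (b + d) z - H (a - c) (- (b + d)) z
    + (H (c - a) (b - d) z + H (c - a) (d - b) z + H (c - a) (b + d) z - H (c - a) (- (b + d)) z)
    + (H (a + c) (b - d) z + H (a + c) (d - b) z + H (a + c) (b + d) z - H (a + c) (- (b + d)) z)
    - (H (- (a + c)) (b - d) z + H (- (a + c)) (d - b) z + H (- (a + c)) (b + d) z - H (- (a + c)) (- (b + d)) z))"
    (is "_ = ?rhs z") for z
  proof -
    have "hartley (a, b) z * hartley (c, d) z
      = (cas (of_int a * fst z) * cas (of_int c * fst z)) * (cas (of_int b * snd z) * cas (of_int d * snd z))"
      by (simp add: hartley_def)
    also have "\<dots> = ?rhs z"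
      unfolding cas_mult by (simp add: H_def hartley_def algebra_simps)
    finally show ?thesis .
  qed
  moreover have "trig_poly ?rhs"
    unfolding H_def by (intro trig_poly.scale trig_poly.add trig_poly_diff trig_poly.basis)
  ultimately show ?thesis by presburger
qed

lemma trig_poly_mult:
  assumes "trig_poly f" "trig_poly g"
  shows "trig_poly (\<lambda>z. f z * g z)"
proof -
  have h: "trig_poly (\<lambda>z. f z * hartley k z)" if "trig_poly f" for f k
    using that
  proof (induction rule: trig_poly.induct)
    case (basis l)
    then show ?case using hartley_mult_trig_poly[of "fst l" "snd l" "fst k" "snd k"] by simp
  next
    case (add f g)
    then show ?case using trig_poly.add by (simp add: distrib_right)
  next
    case (scale f r)
    then show ?case using trig_poly.scale[of "\<lambda>z. f z * hartley k z" r] by (simp add: mult.assoc)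
  qed
  from assms(2) show ?thesis
  proof (induction rule: trig_poly.induct)
    case (basis k)
    then show ?case using h assms(1) by blast
  next
    case (add g1 g2)
    then show ?case using trig_poly.add[of "\<lambda>z. f z * g1 z" "\<lambda>z. f z * g2 z"] by (simp add: distrib_left)
  next
    case (scale g r)
    then show ?case using trig_poly.scale[of "\<lambda>z. f z * g z" r] by (simp add: mult.left_commute)
  qed
qed

lemma hartley_measurable: "hartley k \<in> borel_measurable borel"
  unfolding hartley_def cas_def
  by (intro borel_measurable_continuous_onI continuous_intros)

lemma hartley_L2: "hartley k \<in> L2"
proof (rule L2_bounded)
  show "hartley k \<in> borel_measurable torus"
    by (intro borel_measurable_torus hartley_measurable)
  have "\<bar>hartley k z\<bar> \<le> 2 * 2" for z
    unfolding hartley_def abs_mult by (intro mult_mono abs_cas_le) auto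
  then show "AE z in torus. \<bar>hartley k z\<bar> \<le> 4" by simp
qed

lemma trig_poly_L2: "trig_poly f \<Longrightarrow> f \<in> L2"
  by (induction rule: trig_poly.induct) (auto intro: hartley_L2 L2_add L2_scale)

definition basis_l2 :: "int \<times> int \<Rightarrow> l2" where "basis_l2 k = abs_l2 (hartley k)"

lemma trig_poly_span: "trig_poly f \<Longrightarrow> abs_l2 f \<in> span (range basis_l2)"
proof (induction rule: trig_poly.induct)
  case (basis k)
  then show ?case by (auto intro: span_base simp flip: basis_l2_def)
next
  case (add f g)
  then show ?case by (simp add: trig_poly_L2 span_add flip: abs_l2_plus)
next
  case (scale f r)
  then show ?case by (simp add: trig_poly_L2 span_scale flip: abs_l2_scaleR)
qed

section \<open>Density of trigonometric polynomials in L2\<close>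

definition circles :: "real \<times> real \<Rightarrow> complex \<times> complex" where
  "circles z = (cis (fst z), cis (snd z))"

lemma circles_measurable [measurable]: "circles \<in> borel_measurable borel"
  unfolding circles_def by (intro borel_measurable_continuous_onI continuous_intros)

lemma circles_measurable_torus [measurable]: "circles \<in> borel_measurable torus"
  unfolding torus_def by (rule measurable_restrict_space1) (simp add: circles_measurable)

lemma trig_poly_sincos:
  "trig_poly (\<lambda>z. cos (fst z))" "trig_poly (\<lambda>z. sin (fst z))"
  "trig_poly (\<lambda>z. cos (snd z))" "trig_poly (\<lambda>z. sin (snd z))" "trig_poly (\<lambda>z. r)"
proof -
  have e: "cas (fst z) = hartley (1, 0) z" "cas (- fst z) = hartley (- 1, 0) z"
    "cas (snd z) = hartley (0, 1) z" "cas (- snd z) = hartley (0, - 1) z" "1 = hartley (0, 0) z" for z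
    by (auto simp: hartley_def cas_def)
  show "trig_poly (\<lambda>z. cos (fst z))" "trig_poly (\<lambda>z. sin (fst z))"
    "trig_poly (\<lambda>z. cos (snd z))" "trig_poly (\<lambda>z. sin (snd z))"
    unfolding cos_eq_cas sin_eq_cas e by (intro trig_poly.intros trig_poly_diff)+
  have "trig_poly (\<lambda>z. r * hartley (0, 0) z)" by (intro trig_poly.intros)
  then show "trig_poly (\<lambda>z. r)" unfolding e(5)[symmetric] by simp
qed

text \<open>A linear functional on C^2, a real space of dimension 4, is determined by its values at
  the four coordinate vectors; composed with \<open>circles\<close> it becomes a combination of the
  sines and cosines of the two variables.\<close>

lemma polynomial_circles_trig_poly:
  assumes "real_polynomial_function p"
  shows "trig_poly (\<lambda>z. p (circles z))"
  using assms
proof (induction rule: real_polynomial_function.induct)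
  case (linear p)
  then interpret bounded_linear p .
  have "p (circles z) = p (1, 0) * cos (fst z) + p (\<i>, 0) * sin (fst z)
      + (p (0, 1) * cos (snd z) + p (0, \<i>) * sin (snd z))" for z
  proof -
    have e: "circles z = cos (fst z) *\<^sub>R (1, 0) + sin (fst z) *\<^sub>R (\<i>, 0)
        + (cos (snd z) *\<^sub>R (0, 1) + sin (snd z) *\<^sub>R (0, \<i>))"
      by (simp add: circles_def complex_eq_iff)
    show ?thesis unfolding e by (simp only: add scaleR real_scaleR_def mult.commute)
  qed
  then show ?case by (simp) (intro trig_poly.add trig_poly.scale trig_poly_sincos)
next
  case (const c)
  then show ?case by (rule trig_poly_sincos)
next
  case (add f g)
  from add(3,4) show ?case by (rule trig_poly.add)
next
  case (mult f g)
  from mult(3,4) show ?case by (rule trig_poly_mult)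
qed

lemma L2_dominated:
  assumes "f \<in> borel_measurable torus" "g \<in> L2" "\<And>x. x \<in> space torus \<Longrightarrow> \<bar>f x\<bar> \<le> g x"
  shows "f \<in> L2"
proof -
  have "integrable torus (\<lambda>x. (f x)\<^sup>2)"
  proof (rule Bochner_Integration.integrable_bound)
    show "integrable torus (\<lambda>x. (g x)\<^sup>2)" using assms(2) by (simp add: L2_def)
    show "AE x in torus. norm ((f x)\<^sup>2) \<le> norm ((g x)\<^sup>2)"
    proof (rule AE_I2)
      fix x assume "x \<in> space torus"
      then have "\<bar>f x\<bar>\<^sup>2 \<le> (g x)\<^sup>2" by (intro power_mono assms(3)) auto
      then show "norm ((f x)\<^sup>2) \<le> norm ((g x)\<^sup>2)" by simp
    qed
  qed (use assms(1) in auto)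
  with assms(1) show ?thesis by (simp add: L2_def)
qed

text \<open>Dominated convergence for the squared differences, with majorant
  \<open>4 * (g x)\<^sup>2\<close>. Every limit in the density argument is an instance: uniform, for
  indicators of closed sets, for disjoint unions and for monotone sequences.\<close>

lemma abs_l2_tendsto:
  assumes f: "\<And>n. f n \<in> borel_measurable torus" and f0: "f0 \<in> borel_measurable torus"
    and g: "g \<in> L2" and bound: "\<And>n x. x \<in> space torus \<Longrightarrow> \<bar>f n x\<bar> \<le> g x"
    and lim: "\<And>x. x \<in> space torus \<Longrightarrow> (\<lambda>n. f n x) \<longlonglongrightarrow> f0 x"
  shows "(\<lambda>n. abs_l2 (f n)) \<longlonglongrightarrow> abs_l2 f0"
proof -
  have bound0: "\<bar>f0 x\<bar> \<le> g x" if "x \<in> space torus" for x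
    using tendsto_rabs[OF lim[OF that]] bound[OF that] by (intro LIMSEQ_le_const2) auto
  have L2: "f n \<in> L2" "f0 \<in> L2" for n
    using L2_dominated[OF f g bound] L2_dominated[OF f0 g bound0] by auto
  have "(\<lambda>n. \<integral>x. (f n x - f0 x)\<^sup>2 \<partial>torus) \<longlonglongrightarrow> (\<integral>x. 0 \<partial>torus)"
  proof (rule integral_dominated_convergence)
    show "integrable torus (\<lambda>x. 4 * (g x)\<^sup>2)" using g by (simp add: L2_def)
    show "AE x in torus. (\<lambda>n. (f n x - f0 x)\<^sup>2) \<longlonglongrightarrow> 0"
    proof (rule AE_I2)
      fix x assume "x \<in> space torus"
      from tendsto_power[OF tendsto_diff[OF lim[OF this] tendsto_const], of "f0 x" 2]
      show "(\<lambda>n. (f n x - f0 x)\<^sup>2) \<longlonglongrightarrow> 0" by simp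
    qed
    show "AE x in torus. norm ((f n x - f0 x)\<^sup>2) \<le> 4 * (g x)\<^sup>2" for n
    proof (rule AE_I2)
      fix x assume x: "x \<in> space torus"
      have "\<bar>f n x - f0 x\<bar> \<le> 2 * g x" using bound[OF x, of n] bound0[OF x] by linarith
      then have "\<bar>f n x - f0 x\<bar>\<^sup>2 \<le> (2 * g x)\<^sup>2" by (intro power_mono) auto
      then show "norm ((f n x - f0 x)\<^sup>2) \<le> 4 * (g x)\<^sup>2" by (simp add: power_mult_distrib)
    qed
  qed (use f f0 in measurable)
  from tendsto_real_sqrt[OF this] show ?thesis using L2
    by (subst tendsto_dist_iff) (simp add: dist_norm abs_l2_minus norm_abs_l2 L2_diff L2_norm_def)
qed

abbreviation trig_closure :: "l2 set" where
  "trig_closure \<equiv> closure (span (range basis_l2))"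

lemma trig_closure_limit:
  assumes "\<And>n. h n \<in> trig_closure" "h \<longlonglongrightarrow> l"
  shows "l \<in> trig_closure"
  using closed_sequentially[OF closed_closure] assms by blast

lemma subspace_trig_closure: "subspace trig_closure"
proof (rule subspaceI)
  show "0 \<in> trig_closure" using span_zero[of "range basis_l2"] closure_subset by blast
next
  fix f g assume "f \<in> trig_closure" "g \<in> trig_closure"
  then obtain x y where x: "\<And>n. x n \<in> span (range basis_l2)" "x \<longlonglongrightarrow> f"
    and y: "\<And>n. y n \<in> span (range basis_l2)" "y \<longlonglongrightarrow> g"
    unfolding closure_sequential by blast
  have "\<forall>n. x n + y n \<in> span (range basis_l2)" using x(1) y(1) by (simp add: span_add)
  then show "f + g \<in> trig_closure"
    using tendsto_add[OF x(2) y(2)] unfolding closure_sequential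
    by (intro CollectI exI[of _ "\<lambda>n. x n + y n"] conjI)
next
  fix r f assume "f \<in> trig_closure"
  then obtain x where x: "\<And>n. x n \<in> span (range basis_l2)" "x \<longlonglongrightarrow> f"
    unfolding closure_sequential by blast
  have "\<forall>n. r *\<^sub>R x n \<in> span (range basis_l2)" using x(1) by (simp add: span_scale)
  then show "r *\<^sub>R f \<in> trig_closure"
    using tendsto_scaleR[OF tendsto_const x(2)] unfolding closure_sequential
    by (intro CollectI exI[of _ "\<lambda>n. r *\<^sub>R x n"] conjI)
qed

text \<open>A function of \<open>circles z\<close> is automatically periodic, and the product of two
  unit circles is compact. Polynomials that approximate \<open>g\<close> uniformly there turn into
  trigonometric polynomials.\<close>

lemma continuous_circles_trig_closure:
  fixes g :: "complex \<times> complex \<Rightarrow> real"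
  assumes g: "continuous_on UNIV g"
  shows "(\<lambda>z. g (circles z)) \<in> L2" "abs_l2 (\<lambda>z. g (circles z)) \<in> trig_closure"
proof -
  let ?S = "sphere 0 1 \<times> sphere 0 1 :: (complex \<times> complex) set"
  have S: "compact ?S" by (intro compact_Times) auto
  have in_S: "circles z \<in> ?S" for z by (simp add: circles_def)
  have meas: "(\<lambda>z. g (circles z)) \<in> borel_measurable torus"
    using borel_measurable_continuous_onI[OF g] by measurable
  have "compact (g ` ?S)"
    using g S by (intro compact_continuous_image) (auto intro: continuous_on_subset)
  then obtain B where B: "\<And>w. w \<in> ?S \<Longrightarrow> norm (g w) \<le> B"
    using compact_imp_bounded bounded_iff by (metis imageI)
  then show "(\<lambda>z. g (circles z)) \<in> L2"
    using in_S meas by (intro L2_bounded[where B = B]) auto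
  have "\<exists>p. real_polynomial_function p \<and> (\<forall>w\<in>?S. \<bar>g w - p w\<bar> < 1 / real (Suc n))" for n
    using Stone_Weierstrass_real_polynomial_function[OF S continuous_on_subset[OF g], of "1 / real (Suc n)"]
    by (metis of_nat_0_less_iff subset_UNIV zero_less_Suc zero_less_divide_1_iff)
  then obtain p where p: "\<And>n. real_polynomial_function (p n)"
    "\<And>n w. w \<in> ?S \<Longrightarrow> \<bar>g w - p n w\<bar> < 1 / real (Suc n)" by metis
  have trig: "trig_poly (\<lambda>z. p n (circles z))" for n
    by (rule polynomial_circles_trig_poly[OF p(1)])
  have "(\<lambda>n. abs_l2 (\<lambda>z. p n (circles z))) \<longlonglongrightarrow> abs_l2 (\<lambda>z. g (circles z))"
  proof (rule abs_l2_tendsto[OF L2_measurable[OF trig_poly_L2[OF trig]] meas])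
    show "(\<lambda>z. \<bar>B\<bar> + 1) \<in> L2" by (rule L2_const)
    fix z
    show "\<bar>p n (circles z)\<bar> \<le> \<bar>B\<bar> + 1" for n
    proof -
      have "1 / real (Suc n) \<le> 1" by simp
      then show ?thesis
        using p(2)[OF in_S, of z n] B[OF in_S, of z]
        unfolding real_norm_def by linarith
    qed
    show "(\<lambda>n. p n (circles z)) \<longlonglongrightarrow> g (circles z)"
    proof (rule LIMSEQ_I)
      fix e :: real assume "0 < e"
      then obtain N where N: "1 / real (Suc N) < e" using nat_approx_posE by blast
      show "\<exists>N. \<forall>n\<ge>N. norm (p n (circles z) - g (circles z)) < e"
      proof (intro exI allI impI)
        fix n assume "N \<le> n"
        then have "1 / real (Suc n) \<le> 1 / real (Suc N)" by (simp add: field_simps)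
        then show "norm (p n (circles z) - g (circles z)) < e"
          using p(2)[OF in_S, of z n] N unfolding real_norm_def by linarith
      qed
    qed
  qed
  moreover have "abs_l2 (\<lambda>z. p n (circles z)) \<in> trig_closure" for n
    using trig_poly_span[OF trig] closure_subset by blast
  ultimately show "abs_l2 (\<lambda>z. g (circles z)) \<in> trig_closure"
    by (rule trig_closure_limit[rotated])
qed

lemma indicator_circles_L2:
  assumes "B \<in> sets borel"
  shows "(\<lambda>z. indicator B (circles z) :: real) \<in> L2"
  using assms by (intro L2_bounded[where B = 1]) (measurable, auto simp: indicator_def)

text \<open>Closed sets are stable under intersection and generate the Borel sets, so induction over
  disjoint unions applies; disjointness turns the indicator of a partial union into a sum, which a
  subspace can handle. Closed sets are reached by continuous cut-offs of the distance
  function.\<close>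

lemma indicator_circles_trig_closure:
  assumes "B \<in> sets borel"
  shows "abs_l2 (\<lambda>z. indicator B (circles z)) \<in> trig_closure"
proof -
  have sets: "A \<in> sets borel" if "A \<in> sigma_sets UNIV (Collect closed)" for A :: "(complex \<times> complex) set"
    using that by (simp add: borel_eq_closed)
  have "Int_stable (Collect closed :: (complex \<times> complex) set set)"
    by (auto simp: Int_stable_def)
  moreover have "Collect closed \<subseteq> Pow (UNIV :: (complex \<times> complex) set)" by simp
  moreover have "B \<in> sigma_sets UNIV (Collect closed)"
    using assms by (simp add: borel_eq_closed)
  ultimately show ?thesis
  proof (induction rule: sigma_sets_induct_disjoint)
    case (basic F)
    then have F: "closed F" by simp
    show ?case
    \<comment> \<open>The distance \<open>infdist\<close> to the empty set is 0 by convention, so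
      the cut-offs would tend to 1 instead of 0.\<close>
    proof (cases "F = {}")
      case True
      then show ?thesis
        using subspace_0[OF subspace_trig_closure] by (simp add: zero_l2.abs_eq)
    next
      case False
      let ?g = "\<lambda>n w. max 0 (1 - real n * infdist w F)"
      have cont: "continuous_on UNIV (?g n)" for n by (intro continuous_intros)
      have "(\<lambda>n. abs_l2 (\<lambda>z. ?g n (circles z))) \<longlonglongrightarrow> abs_l2 (\<lambda>z. indicator F (circles z))"
      proof (rule abs_l2_tendsto)
        show "(\<lambda>z. ?g n (circles z)) \<in> borel_measurable torus" for n
          by (rule L2_measurable[OF continuous_circles_trig_closure(1)[OF cont]])
        show "(\<lambda>z. indicator F (circles z) :: real) \<in> borel_measurable torus"
          by (intro L2_measurable indicator_circles_L2 borel_closed F)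
        show "(\<lambda>_. 1) \<in> L2" by (rule L2_const)
        show "\<bar>?g n (circles z)\<bar> \<le> 1" for n z by (auto simp: infdist_nonneg)
        fix z
        show "(\<lambda>n. ?g n (circles z)) \<longlonglongrightarrow> indicator F (circles z)"
        proof (cases "circles z \<in> F")
          case True
          then show ?thesis by simp
        next
          case out: False
          then have pos: "0 < infdist (circles z) F"
            using infdist_pos_not_in_closed[OF F False] by simp
          obtain N where N: "1 / infdist (circles z) F < real N" using reals_Archimedean2 by blast
          have "?g n (circles z) = 0" if "N \<le> n" for n
          proof -
            have "1 < real N * infdist (circles z) F" using N pos by (simp add: field_simps)
            also have "\<dots> \<le> real n * infdist (circles z) F" using that pos by (intro mult_right_mono) auto
            finally show ?thesis by simp
          qed
          then have "eventually (\<lambda>n. ?g n (circles z) = 0) sequentially"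
            using eventually_sequentially by blast
          then show ?thesis using out by (simp add: tendsto_eventually)
        qed
      qed
      then show ?thesis
        by (rule trig_closure_limit[OF continuous_circles_trig_closure(2)[OF cont]])
    qed
  next
    case empty
    then show ?case
      using subspace_0[OF subspace_trig_closure] by (simp add: zero_l2.abs_eq)
  next
    case (compl A)
    have "abs_l2 (\<lambda>z. 1) \<in> trig_closure"
      using continuous_circles_trig_closure(2)[of "\<lambda>_. 1"] by simp
    from subspace_diff[OF subspace_trig_closure this compl(2)]
    have "abs_l2 (\<lambda>z. 1 - indicator A (circles z)) \<in> trig_closure"
      using indicator_circles_L2[OF sets[OF compl(1)]] by (simp add: abs_l2_minus L2_const)
    also have "(\<lambda>z. 1 - indicator A (circles z)) = (\<lambda>z. indicator (UNIV - A) (circles z) :: real)"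
      by (auto simp: indicator_def)
    finally show ?case .
  next
    case (union A)
    have A: "A i \<in> sets borel" for i using union(2) sets by auto
    let ?s = "\<lambda>n z. indicator (\<Union>i<n. A i) (circles z) :: real"
    have s: "?s n z = (\<Sum>i<n. indicator (A i) (circles z))" for n z
      using union(1) by (subst indicator_UN_disjoint) (auto simp: disjoint_family_on_def)
    have L2s: "?s n \<in> L2" for n using A by (intro indicator_circles_L2) auto
    have "abs_l2 (?s n) \<in> trig_closure" for n
    proof (induction n)
      case 0
      then show ?case using subspace_0[OF subspace_trig_closure] by (simp add: zero_l2.abs_eq)
    next
      case (Suc n)
      have "abs_l2 (?s (Suc n)) = abs_l2 (?s n) + abs_l2 (\<lambda>z. indicator (A n) (circles z))"
        using L2s[of n] indicator_circles_L2[OF A[of n]] by (simp only: abs_l2_plus s sum.lessThan_Suc)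
      then show ?case using Suc union(3)[of n] subspace_add[OF subspace_trig_closure] by simp
    qed
    moreover have "(\<lambda>n. abs_l2 (?s n)) \<longlonglongrightarrow> abs_l2 (\<lambda>z. indicator (\<Union>i. A i) (circles z))"
    proof (rule abs_l2_tendsto[OF L2_measurable[OF L2s]])
      show "(\<lambda>z. indicator (\<Union>i. A i) (circles z) :: real) \<in> borel_measurable torus"
        using A by (intro L2_measurable indicator_circles_L2) auto
      show "(\<lambda>_. 1) \<in> L2" by (rule L2_const)
      show "\<bar>?s n z\<bar> \<le> 1" for n z by (auto simp: indicator_def)
      show "(\<lambda>n. ?s n z) \<longlonglongrightarrow> indicator (\<Union>i. A i) (circles z)" for z
        by (rule LIMSEQ_indicator_UN)
    qed
    ultimately show ?case by (rule trig_closure_limit)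
  qed
qed

text \<open>A Borel inverse of \<open>cis\<close> on the half-open interval from -\<pi> to \<pi>.
  The strict test on \<open>Im w\<close> sends -1 to -\<pi>, in accordance with the fundamental
  domain; clamping \<open>Re w\<close> makes the \<open>arccos\<close> factor continuous on the
  whole plane.\<close>

definition angle :: "complex \<Rightarrow> real" where
  "angle w = (if 0 < Im w then 1 else - 1) * arccos (max (- 1) (min 1 (Re w)))"

lemma angle_measurable: "angle \<in> borel_measurable borel"
proof -
  have "(\<lambda>w. arccos (max (- 1) (min 1 (Re w)))) \<in> borel_measurable borel"
    by (intro borel_measurable_continuous_onI continuous_intros) auto
  then show ?thesis unfolding angle_def by measurable
qed

lemma angle_cis:
  assumes "- pi \<le> x" "x < pi"
  shows "angle (cis x) = x"
proof (cases "0 < x")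
  case True
  then have "0 < sin x" using assms by (simp add: sin_gt_zero)
  with True assms show ?thesis by (simp add: angle_def arccos_cos)
next
  case False
  then have "0 \<le> sin (- x)" using assms by (intro sin_ge_zero) auto
  then have "\<not> 0 < sin x" by simp
  moreover have "arccos (cos x) = - x" using arccos_cos[of "- x"] False assms by simp
  ultimately show ?thesis by (simp add: angle_def)
qed

text \<open>\<open>angle\<close> in each coordinate is a left inverse of \<open>circles\<close> on
  the fundamental square, so there \<open>A\<close> coincides with the preimage under
  \<open>circles\<close> of a Borel set.\<close>

lemma indicator_trig_closure:
  assumes "A \<in> sets torus"
  shows "indicator A \<in> L2" "abs_l2 (indicator A) \<in> trig_closure"
proof -
  obtain A0 where "A0 \<in> sets borel" "A = ({-pi..<pi} \<times> {-pi..<pi}) \<inter> A0"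
    using assms unfolding torus_def sets_restrict_space by auto
  then have A: "A \<in> sets borel" using sets.Int[OF torus_square_borel, of A0] by simp
  have "(\<lambda>w. (angle (fst w), angle (snd w))) \<in> borel_measurable borel"
    by (intro borel_measurable_Pair measurable_compose[OF _ angle_measurable]
        borel_measurable_continuous_onI continuous_intros)
  from measurable_sets[OF this A]
  have B: "(\<lambda>w. (angle (fst w), angle (snd w))) -` A \<in> sets borel" by simp
  have "AE z in torus. indicator ((\<lambda>w. (angle (fst w), angle (snd w))) -` A) (circles z) = (indicator A z :: real)"
    by (rule AE_I2) (auto simp: space_torus circles_def angle_cis indicator_def)
  moreover show "indicator A \<in> L2"
    using A by (intro L2_bounded[where B = 1]) (auto simp: indicator_def intro: borel_measurable_torus)
  ultimately show "abs_l2 (indicator A) \<in> trig_closure"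
    using indicator_circles_trig_closure[OF B] indicator_circles_L2[OF B] abs_l2_eq_iff by metis
qed

lemma nonneg_trig_closure:
  assumes "f \<in> L2" "\<And>x. 0 \<le> f x"
  shows "abs_l2 f \<in> trig_closure"
proof -
  \<comment> \<open>Square integrability is part of the induction claim, since the rule speaks of
    measurable functions only. The nonnegative building blocks are dominated by the function they
    build, up to a nonzero factor, and so inherit it.\<close>
  have "f \<in> L2 \<longrightarrow> abs_l2 f \<in> trig_closure"
    using L2_measurable[OF assms(1)] assms(2)
  proof (induction rule: borel_measurable_induct_real)
    case (set A)
    then show ?case using indicator_trig_closure by blast
  next
    case (mult u c)
    show ?case
    proof (cases "c = 0")
      case True
      then show ?thesis using subspace_0[OF subspace_trig_closure] by (simp add: zero_l2.abs_eq)
    next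
      case False
      show ?thesis
      proof
        assume "(\<lambda>x. c * u x) \<in> L2"
        from L2_scale[OF this, of "1 / c"] have u: "u \<in> L2" using False by simp
        with mult have "abs_l2 u \<in> trig_closure" by blast
        from subspace_scale[OF subspace_trig_closure this, of c]
        show "abs_l2 (\<lambda>x. c * u x) \<in> trig_closure" using u by (simp add: abs_l2_scaleR)
      qed
    qed
  next
    case (add u v)
    show ?case
    proof
      assume s: "(\<lambda>x. v x + u x) \<in> L2"
      have uv: "u \<in> L2" "v \<in> L2"
        by (rule L2_dominated[OF _ s]; use add in simp)+
      with add have "abs_l2 u \<in> trig_closure" "abs_l2 v \<in> trig_closure" by auto
      from subspace_add[OF subspace_trig_closure this(2,1)]
      show "abs_l2 (\<lambda>x. v x + u x) \<in> trig_closure" using uv by (simp add: abs_l2_plus)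
    qed
  next
    case (seq U)
    show ?case
    proof
      assume f: "f \<in> L2"
      have le: "\<bar>U i x\<bar> \<le> f x" if "x \<in> space torus" for i x
      proof -
        have "incseq (\<lambda>i. U i x)" using seq(3) by (auto simp: incseq_def le_fun_def simp del: split_paired_All)
        from incseq_le[OF this seq(4)[OF that], of i] seq(2)[of i x] show ?thesis by simp
      qed
      have "U i \<in> L2" for i by (rule L2_dominated[OF seq(1) f le])
      with seq(5) have "abs_l2 (U i) \<in> trig_closure" for i by blast
      moreover have "(\<lambda>i. abs_l2 (U i)) \<longlonglongrightarrow> abs_l2 f"
        by (rule abs_l2_tendsto[OF seq(1) L2_measurable[OF f] f le seq(4)])
      ultimately show "abs_l2 f \<in> trig_closure" by (rule trig_closure_limit)
    qed
  qed
  with assms show ?thesis by blast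
qed

lemma trig_closure_UNIV: "trig_closure = UNIV"
proof -
  have "h \<in> trig_closure" for h
  proof -
    obtain f where f: "f \<in> L2" "h = abs_l2 f" by (rule abs_l2_cases)
    have p: "(\<lambda>x. max 0 (f x)) \<in> L2" "(\<lambda>x. max 0 (- f x)) \<in> L2"
    proof -
      have "(\<lambda>x. \<bar>f x\<bar>) \<in> L2" using f(1) by (auto simp: L2_def)
      then show "(\<lambda>x. max 0 (f x)) \<in> L2" "(\<lambda>x. max 0 (- f x)) \<in> L2"
        using L2_measurable[OF f(1)] by (auto intro: L2_dominated)
    qed
    have "abs_l2 (\<lambda>x. max 0 (f x)) - abs_l2 (\<lambda>x. max 0 (- f x)) \<in> trig_closure"
      by (intro subspace_diff[OF subspace_trig_closure] nonneg_trig_closure p) auto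
    also have "abs_l2 (\<lambda>x. max 0 (f x)) - abs_l2 (\<lambda>x. max 0 (- f x)) = h"
      unfolding abs_l2_minus[OF p] f(2) by (rule arg_cong[where f = abs_l2]) (auto simp: max_def)
    finally show ?thesis .
  qed
  then show ?thesis by blast
qed

section \<open>Orthogonality of the product basis\<close>

lemma integral_torus_product:
  fixes g h :: "real \<Rightarrow> real"
  assumes g: "continuous_on UNIV g" and h: "continuous_on UNIV h"
  shows "(\<integral>z. g (fst z) * h (snd z) \<partial>torus)
    = (\<integral>x. indicator {-pi..pi} x *\<^sub>R g x \<partial>lborel) * (\<integral>x. indicator {-pi..pi} x *\<^sub>R h x \<partial>lborel)"
proof -
  let ?I = "{-pi..<pi}"
  define a where "a x = indicator ?I x * g x" for x
  define b where "b x = indicator ?I x * h x" for x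
  have int: "integrable lborel (\<lambda>x. indicator ?I x * f x)" if "continuous_on UNIV f" for f :: "real \<Rightarrow> real"
  proof -
    have "set_integrable lborel {-pi..pi} f"
      using borel_integrable_compact[of "{-pi..pi}" f] that continuous_on_subset
      by (auto simp: set_integrable_def)
    then have "set_integrable lborel ?I f" by (rule set_integrable_subset) auto
    then show ?thesis by (simp add: set_integrable_def)
  qed
  \<comment> \<open>The fundamental theorem of calculus used for \<open>cas\<close> concerns closed
    intervals; the added endpoint is a null set.\<close>
  have closed_eq: "(\<integral>x. indicator ?I x * f x \<partial>lborel) = (\<integral>x. indicator {-pi..pi} x *\<^sub>R f x \<partial>lborel)"
    if "continuous_on UNIV f" for f :: "real \<Rightarrow> real"
  proof (rule integral_cong_AE)
    have [measurable]: "f \<in> borel_measurable borel" using that by (rule borel_measurable_continuous_onI)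
    show "(\<lambda>x. indicator ?I x * f x) \<in> borel_measurable lborel"
      "(\<lambda>x. indicator {-pi..pi} x *\<^sub>R f x) \<in> borel_measurable lborel" by measurable
    show "AE x in lborel. indicator ?I x * f x = indicator {-pi..pi} x *\<^sub>R f x"
      using AE_lborel_singleton[of pi] by eventually_elim (auto simp: indicator_def)
  qed
  have ab: "integrable lborel a" "integrable lborel b"
    unfolding a_def b_def by (intro int g h)+
  have [measurable]: "a \<in> borel_measurable borel" "b \<in> borel_measurable borel"
    using ab by auto
  have "(\<integral>z. g (fst z) * h (snd z) \<partial>torus) = (\<integral>z. a (fst z) * b (snd z) \<partial>lborel)"
  proof -
    have "(\<integral>z. g (fst z) * h (snd z) \<partial>torus) = (\<integral>z. indicator (?I \<times> ?I) z *\<^sub>R (g (fst z) * h (snd z)) \<partial>lborel)"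
      unfolding torus_def using torus_square_borel by (intro integral_restrict_space) simp
    also have "(\<lambda>z. indicator (?I \<times> ?I) z *\<^sub>R (g (fst z) * h (snd z))) = (\<lambda>z. a (fst z) * b (snd z))"
      by (auto simp: a_def b_def indicator_def)
    finally show ?thesis .
  qed
  also have "\<dots> = (\<integral>z. a (fst z) * b (snd z) \<partial>(lborel \<Otimes>\<^sub>M lborel))" by (simp only: lborel_prod)
  also have "\<dots> = (\<integral>x. (\<integral>y. a x * b y \<partial>lborel) \<partial>lborel)"
  proof -
    have "integrable (lborel \<Otimes>\<^sub>M lborel) (\<lambda>z. a (fst z) * b (snd z))"
      by (rule lborel_pair.Fubini_integrable) (use ab in \<open>auto simp: abs_mult\<close>)
    from lborel_pair.integral_fst'[OF this] show ?thesis by simp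
  qed
  also have "\<dots> = (\<integral>x. a x \<partial>lborel) * (\<integral>y. b y \<partial>lborel)" by simp
  finally show ?thesis unfolding a_def b_def closed_eq[OF g] closed_eq[OF h] .
qed

lemma integral_cas: "has_bochner_integral lborel (\<lambda>x. indicator {-pi..pi} x *\<^sub>R cas (of_int n * x)) (if n = 0 then 2 * pi else 0)"
proof (cases "n = 0")
  case True
  have "has_bochner_integral lborel (\<lambda>x. indicator {-pi..pi} x *\<^sub>R (1::real)) (pi - - pi)"
    by (rule has_bochner_integral_FTC_Icc) (auto intro!: derivative_eq_intros)
  with True show ?thesis by (simp add: cas_def)
next
  case False
  let ?F = "\<lambda>x. - cas (- (of_int n * x)) / of_int n"
  have "has_bochner_integral lborel (\<lambda>x. indicator {-pi..pi} x *\<^sub>R cas (of_int n * x)) (?F pi - ?F (- pi))"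
  proof (rule has_bochner_integral_FTC_Icc)
    show "(?F has_vector_derivative cas (of_int n * x)) (at x within {-pi..pi})" for x
      unfolding cas_def using False
      by (auto intro!: derivative_eq_intros simp: field_simps simp flip: has_real_derivative_iff_has_vector_derivative)
    show "continuous_on {-pi..pi} (\<lambda>x. cas (of_int n * x))"
      unfolding cas_def by (intro continuous_intros)
  qed auto
  with False show ?thesis by (simp add: cas_def mult.commute)
qed

lemma integral_cas_mult:
  "(\<integral>x. indicator {-pi..pi} x *\<^sub>R (cas (of_int m * x) * cas (of_int n * x)) \<partial>lborel)
    = (if m = n then 2 * pi else 0)"
proof -
  let ?c = "\<lambda>k. if k = 0 then 2 * pi else 0"
  have int: "has_bochner_integral lborel (\<lambda>x. 1 / 2 * (indicator {-pi..pi} x *\<^sub>R cas (of_int (m - n) * x)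
      + indicator {-pi..pi} x *\<^sub>R cas (of_int (n - m) * x)
      + indicator {-pi..pi} x *\<^sub>R cas (of_int (m + n) * x)
      - indicator {-pi..pi} x *\<^sub>R cas (of_int (- (m + n)) * x)))
    (1 / 2 * (?c (m - n) + ?c (n - m) + ?c (m + n) - ?c (- (m + n))))"
    by (intro has_bochner_integral_mult_right has_bochner_integral_diff has_bochner_integral_add integral_cas)
  \<comment> \<open>For \<open>m = n\<close> the two difference frequencies contribute
    \<open>2 * pi\<close> each. The two sum frequencies vanish only together and enter with opposite
    signs, so they cancel.\<close>
  have val: "1 / 2 * (?c (m - n) + ?c (n - m) + ?c (m + n) - ?c (- (m + n))) = (if m = n then 2 * pi else 0)"
    by auto
  have fn: "(\<lambda>x. 1 / 2 * (indicator {-pi..pi} x *\<^sub>R cas (of_int (m - n) * x)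
      + indicator {-pi..pi} x *\<^sub>R cas (of_int (n - m) * x)
      + indicator {-pi..pi} x *\<^sub>R cas (of_int (m + n) * x)
      - indicator {-pi..pi} x *\<^sub>R cas (of_int (- (m + n)) * x)))
    = (\<lambda>x. indicator {-pi..pi} x *\<^sub>R (cas (of_int m * x) * cas (of_int n * x)))"
    unfolding cas_mult by (rule ext) (simp add: algebra_simps)
  show ?thesis by (rule has_bochner_integral_integral_eq[OF int[unfolded val fn]])
qed

lemma inner_basis_l2: "inner (basis_l2 k) (basis_l2 l) = (if k = l then 4 * pi\<^sup>2 else 0)"
proof -
  have "inner (basis_l2 k) (basis_l2 l) = (\<integral>z. (cas (of_int (fst k) * fst z) * cas (of_int (fst l) * fst z))
      * (cas (of_int (snd k) * snd z) * cas (of_int (snd l) * snd z)) \<partial>torus)"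
    by (simp add: basis_l2_def inner_abs_l2 hartley_L2 hartley_def mult_ac)
  also have "\<dots> = (if fst k = fst l then 2 * pi else 0) * (if snd k = snd l then 2 * pi else 0)"
    unfolding integral_cas_mult[symmetric]
    by (rule integral_torus_product; unfold cas_def; intro continuous_intros)
  finally show ?thesis by (auto simp: prod_eq_iff power2_eq_square)
qed

interpretation hartley: orthogonal_basis basis_l2 "4 * pi\<^sup>2"
  by standard (simp_all add: inner_basis_l2 trig_closure_UNIV)

section \<open>Weak derivatives as Fourier multipliers\<close>

text \<open>A derivative of \<open>cas (a * x)\<close> is \<open>a * cas (- (a * x))\<close>. With a
  free factor and free frequencies the family is closed under both partial derivatives, so all
  iterated derivatives are explicit.\<close>

definition cas_product :: "real \<Rightarrow> real \<Rightarrow> real \<Rightarrow> real \<times> real \<Rightarrow> real" where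
  "cas_product c a b z = c * cas (a * fst z) * cas (b * snd z)"

lemma pderiv1_cas_product: "pderiv1 (cas_product c a b) = cas_product (c * a) (- a) b"
proof
  fix z :: "real \<times> real"
  have "((\<lambda>s. c * cas (a * s) * cas (b * snd z)) has_real_derivative
      c * a * cas (- a * fst z) * cas (b * snd z)) (at (fst z))"
    using DERIV_cmult[OF DERIV_cmult_right[OF cas_has_derivative[of a "fst z" UNIV], of "cas (b * snd z)"], of c]
    by (simp add: mult_ac)
  then show "pderiv1 (cas_product c a b) z = cas_product (c * a) (- a) b z"
    by (simp add: pderiv1_def cas_product_def case_prod_beta DERIV_imp_deriv)
qed

lemma pderiv2_cas_product: "pderiv2 (cas_product c a b) = cas_product (c * b) a (- b)"
proof
  fix z :: "real \<times> real"
  have "((\<lambda>s. c * cas (a * fst z) * cas (b * s)) has_real_derivative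
      c * b * cas (a * fst z) * cas (- b * snd z)) (at (snd z))"
    using DERIV_cmult[OF cas_has_derivative[of b "snd z" UNIV], of "c * cas (a * fst z)"]
    by (simp add: mult_ac)
  then show "pderiv2 (cas_product c a b) z = cas_product (c * b) a (- b) z"
    by (simp add: pderiv2_def cas_product_def case_prod_beta DERIV_imp_deriv)
qed

lemma pderivs_cas_product: "\<exists>c' a' b'. pderivs i j (cas_product c a b) = cas_product c' a' b'"
proof -
  have "\<exists>c' b'. (pderiv2 ^^ j) (cas_product c a b) = cas_product c' a b'"
    by (induction j) (auto, metis pderiv2_cas_product)
  moreover have "\<exists>c' a'. (pderiv1 ^^ i) (cas_product c a b) = cas_product c' a' b" for c a b
    by (induction i) (auto, metis pderiv1_cas_product)
  ultimately show ?thesis unfolding pderivs_def by metis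
qed

lemma cas_product_differentiable: "cas_product c a b differentiable_on S"
proof -
  have "(\<lambda>z. cos (a * fst z)) differentiable (at z within S)"
    "(\<lambda>z. sin (a * fst z)) differentiable (at z within S)"
    "(\<lambda>z. cos (b * snd z)) differentiable (at z within S)"
    "(\<lambda>z. sin (b * snd z)) differentiable (at z within S)" for z :: "real \<times> real"
    by (rule differentiableI, (rule derivative_eq_intros refl)+)+
  then show ?thesis
    unfolding differentiable_on_def cas_product_def cas_def
    by (intro ballI differentiable_mult differentiable_add differentiable_const)
qed

lemma hartley_eq_cas_product: "hartley k = cas_product 1 (of_int (fst k)) (of_int (snd k))"
  by (rule ext) (simp add: hartley_def cas_product_def)

lemma cas_periodic: "cas (of_int n * (x + 2 * pi)) = cas (of_int n * x)"
proof -
  have e: "of_int n * (x + 2 * pi) = of_int n * x + 2 * pi * of_int n" by (simp add: algebra_simps)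
  show ?thesis by (simp only: e cas_def sin_add cos_add sin_int_2pin cos_int_2pin)
qed

lemma test_function_hartley: "test_function (hartley k)"
  unfolding test_function_def
proof (intro conjI allI)
  show "pderivs i j (hartley k) differentiable_on UNIV" for i j
    using pderivs_cas_product[of i j] cas_product_differentiable unfolding hartley_eq_cas_product by metis
  show "hartley k (x + 2 * pi, y) = hartley k (x, y)" "hartley k (x, y + 2 * pi) = hartley k (x, y)" for x y
    by (simp_all add: hartley_def cas_periodic)
qed

lemma has_weak_deriv_L2: "has_weak_deriv i j f g \<Longrightarrow> f \<in> L2" "has_weak_deriv i j f g \<Longrightarrow> g \<in> L2"
  by (simp_all add: has_weak_deriv_def)

text \<open>Even total order makes the sign from integration by parts +1. A single derivative
  reverses the sign of a frequency, so the hypothesis on \<open>pderivs\<close> suits orders that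
  are even in each variable, such as those in the Laplacian.\<close>

lemma weak_deriv_coefficient:
  assumes w: "has_weak_deriv i j f g" and ev: "even (i + j)"
    and p: "pderivs i j (hartley k) = (\<lambda>z. m * hartley k z)"
  shows "inner (abs_l2 g) (basis_l2 k) = m * inner (abs_l2 f) (basis_l2 k)"
proof -
  have "(\<integral>x. f x * pderivs i j (hartley k) x \<partial>torus) = (-1) ^ (i + j) * (\<integral>x. g x * hartley k x \<partial>torus)"
    using w test_function_hartley[of k] unfolding has_weak_deriv_def by blast
  then have "(\<integral>x. f x * (m * hartley k x) \<partial>torus) = (\<integral>x. g x * hartley k x \<partial>torus)"
    by (simp only: p neg_one_even_power[OF ev] mult_1)
  then show ?thesis
    using has_weak_deriv_L2[OF w]
    by (simp add: basis_l2_def inner_abs_l2 hartley_L2 mult.left_commute)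
qed

lemma pderivs_hartley:
  "pderivs 0 0 (hartley k) = (\<lambda>z. 1 * hartley k z)"
  "pderivs 2 0 (hartley k) = (\<lambda>z. - (of_int (fst k))\<^sup>2 * hartley k z)"
  "pderivs 0 2 (hartley k) = (\<lambda>z. - (of_int (snd k))\<^sup>2 * hartley k z)"
  by (simp_all add: pderivs_def hartley_eq_cas_product numeral_2_eq_2 pderiv1_cas_product
      pderiv2_cas_product fun_eq_iff cas_product_def)

text \<open>The Laplacian through its Fourier symbol. Being a condition on coefficients only, it is
  linear at sight and symmetric by \<open>hartley.inner_eq_of_multiplier\<close>.\<close>

definition lap_l2 :: "l2 \<Rightarrow> l2 \<Rightarrow> bool" where
  "lap_l2 f g \<longleftrightarrow> (\<forall>k. inner g (basis_l2 k)
     = - ((of_int (fst k))\<^sup>2 + (of_int (snd k))\<^sup>2) * inner f (basis_l2 k))"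

interpretation lap: symmetric_operator lap_l2
proof
  fix f g f' g' :: l2 and r :: real
  assume fg: "lap_l2 f g"
  show "lap_l2 (r *\<^sub>R f) (r *\<^sub>R g)" using fg by (simp add: lap_l2_def)
  assume "lap_l2 f' g'"
  with fg show "lap_l2 (f + f') (g + g')" by (simp add: lap_l2_def inner_add_left distrib_left)
  show "inner g f' = inner f g'"
    using fg \<open>lap_l2 f' g'\<close> unfolding lap_l2_def by (intro hartley.inner_eq_of_multiplier) blast+
qed

lemma has_laplacian_lap_l2:
  assumes "has_laplacian f g"
  shows "f \<in> L2" "g \<in> L2" "lap_l2 (abs_l2 f) (abs_l2 g)"
proof -
  obtain a b where a: "has_weak_deriv 2 0 f a" and b: "has_weak_deriv 0 2 f b"
    and g: "g = (\<lambda>x. a x + b x)"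
    using assms unfolding has_laplacian_def by blast
  note L2 = has_weak_deriv_L2[OF a] has_weak_deriv_L2[OF b]
  show "f \<in> L2" "g \<in> L2" using L2 unfolding g by (auto intro: L2_add)
  show "lap_l2 (abs_l2 f) (abs_l2 g)"
    unfolding lap_l2_def g abs_l2_plus[OF L2(2,4), symmetric] inner_add_left
    using weak_deriv_coefficient[OF a _ pderivs_hartley(2)] weak_deriv_coefficient[OF b _ pderivs_hartley(3)]
    by (simp add: algebra_simps)
qed

section \<open>From Sobolev norms to L2: representatives and time derivatives\<close>

lemma L2_norm_weak_deriv_0:
  assumes "f \<in> L2"
  shows "L2_norm (weak_deriv 0 0 f) = L2_norm f"
proof -
  have "has_weak_deriv 0 0 f f" using assms by (simp add: has_weak_deriv_def pderivs_def)
  then have w: "has_weak_deriv 0 0 f (weak_deriv 0 0 f)" unfolding weak_deriv_def by (rule someI[of "has_weak_deriv 0 0 f"])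
  \<comment> \<open>Even at order zero \<open>weak_deriv\<close> is an arbitrary choice; equal
    coefficients identify it with \<open>f\<close> up to a null set.\<close>
  have "abs_l2 (weak_deriv 0 0 f) - abs_l2 f = 0"
    using weak_deriv_coefficient[OF w _ pderivs_hartley(1)]
    by (intro hartley.coefficients_zero_imp_zero) (simp add: inner_diff_left)
  then show ?thesis
    using has_weak_deriv_L2[OF w] by (metis norm_abs_l2 right_minus_eq)
qed

text \<open>The summand of order zero already dominates, whatever values the choice in
  \<open>weak_deriv\<close> gives to the others. So it applies to difference quotients known only to
  lie in \<open>L2\<close>.\<close>

lemma L2_norm_le_sobolev_norm:
  assumes "f \<in> L2"
  shows "L2_norm f \<le> sobolev_norm s f"
proof -
  have fin: "finite {(i, j). i + j \<le> s}"
    by (rule finite_subset[of _ "{..s} \<times> {..s}"]) auto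
  have "(L2_norm (weak_deriv 0 0 f))\<^sup>2 \<le> (\<Sum>(i, j)\<in>{(i, j). i + j \<le> s}. (L2_norm (weak_deriv i j f))\<^sup>2)"
    using member_le_sum[of "(0, 0)" "{(i, j). i + j \<le> s}" "\<lambda>(i, j). (L2_norm (weak_deriv i j f))\<^sup>2"] fin
    by auto
  then have "\<bar>L2_norm f\<bar> \<le> sobolev_norm s f"
    unfolding sobolev_norm_def L2_norm_weak_deriv_0[OF assms] by (simp add: real_le_rsqrt)
  then show ?thesis by simp
qed

lemma sobolev_L2: "f \<in> sobolev s \<Longrightarrow> f \<in> L2"
proof -
  assume "f \<in> sobolev s"
  then have "\<forall>i j. i + j \<le> s \<longrightarrow> (\<exists>g. has_weak_deriv i j f g)" by (simp add: sobolev_def)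
  from this[rule_format, of 0 0] show ?thesis using has_weak_deriv_L2(1) by auto
qed

lemma sobolev_time_deriv_l2:
  assumes der: "sobolev_has_time_deriv s u ut" and u: "\<And>t. 0 \<le> t \<Longrightarrow> u t \<in> L2"
    and ut: "\<And>t. 0 \<le> t \<Longrightarrow> ut t \<in> L2" and t: "0 \<le> t"
  shows "((\<lambda>t. abs_l2 (u t)) has_vector_derivative abs_l2 (ut t)) (at t within {0..})"
proof -
  have "((\<lambda>r. norm ((1 / (r - t)) *\<^sub>R (abs_l2 (u r) - abs_l2 (u t)) - abs_l2 (ut t))) \<longlongrightarrow> 0) (at t within {0..})"
  proof (rule tendsto_sandwich[where f = "\<lambda>_. 0"])
    show "((\<lambda>r. sobolev_norm s (\<lambda>x. (u r x - u t x) / (r - t) - ut t x)) \<longlongrightarrow> 0) (at t within {0..})"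
      using der t unfolding sobolev_has_time_deriv_def by blast
    have "norm ((1 / (r - t)) *\<^sub>R (abs_l2 (u r) - abs_l2 (u t)) - abs_l2 (ut t))
        \<le> sobolev_norm s (\<lambda>x. (u r x - u t x) / (r - t) - ut t x)" if "0 \<le> r" for r
    proof -
      have q: "(\<lambda>x. 1 / (r - t) * (u r x - u t x) - ut t x) \<in> L2"
        by (intro L2_diff L2_scale u ut t that)
      have "norm ((1 / (r - t)) *\<^sub>R (abs_l2 (u r) - abs_l2 (u t)) - abs_l2 (ut t))
          = L2_norm (\<lambda>x. 1 / (r - t) * (u r x - u t x) - ut t x)"
        unfolding abs_l2_minus[OF u[OF that] u[OF t]] abs_l2_scaleR[OF L2_diff[OF u[OF that] u[OF t]]]
          abs_l2_minus[OF L2_scale[OF L2_diff[OF u[OF that] u[OF t]]] ut[OF t]] norm_abs_l2[OF q] ..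
      also have "\<dots> \<le> sobolev_norm s (\<lambda>x. 1 / (r - t) * (u r x - u t x) - ut t x)"
        by (rule L2_norm_le_sobolev_norm[OF q])
      finally show ?thesis by simp
    qed
    then show "\<forall>\<^sub>F r in at t within {0..}. norm ((1 / (r - t)) *\<^sub>R (abs_l2 (u r) - abs_l2 (u t)) - abs_l2 (ut t))
        \<le> sobolev_norm s (\<lambda>x. (u r x - u t x) / (r - t) - ut t x)"
      by (auto simp: eventually_at_filter)
  qed auto
  moreover have "\<forall>\<^sub>F r in at t within {0..}.
      norm ((1 / (r - t)) *\<^sub>R (abs_l2 (u r) - abs_l2 (u t)) - abs_l2 (ut t))
      = norm (abs_l2 (u r) - abs_l2 (u t) - (r - t) *\<^sub>R abs_l2 (ut t)) / norm (r - t)"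
    unfolding eventually_at_filter
  proof (intro always_eventually allI impI)
    fix r assume "r \<noteq> t"
    then have "abs_l2 (u r) - abs_l2 (u t) - (r - t) *\<^sub>R abs_l2 (ut t)
        = (r - t) *\<^sub>R ((1 / (r - t)) *\<^sub>R (abs_l2 (u r) - abs_l2 (u t)) - abs_l2 (ut t))"
      by (simp add: scaleR_diff_right)
    then show "norm ((1 / (r - t)) *\<^sub>R (abs_l2 (u r) - abs_l2 (u t)) - abs_l2 (ut t))
      = norm (abs_l2 (u r) - abs_l2 (u t) - (r - t) *\<^sub>R abs_l2 (ut t)) / norm (r - t)"
      using \<open>r \<noteq> t\<close> by (simp only: norm_scaleR) simp
  qed
  ultimately have "((\<lambda>r. norm (abs_l2 (u r) - abs_l2 (u t) - (r - t) *\<^sub>R abs_l2 (ut t)) / norm (r - t)) \<longlongrightarrow> 0)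
      (at t within {0..})"
    by (rule Lim_transform_eventually)
  then show ?thesis
    unfolding has_vector_derivative_def has_derivative_iff_norm
    by (simp add: bounded_linear_scaleR_left)
qed

section \<open>Lipschitz bounds for the logarithmic nonlinearity\<close>

lemma f_tilde_lipschitz:
  assumes "0 < \<delta>" "0 \<le> \<theta>" "\<bar>z\<bar> \<le> 1 - \<delta>" "\<bar>w\<bar> \<le> 1 - \<delta>"
  shows "\<bar>f_tilde \<theta> z - f_tilde \<theta> w\<bar> \<le> \<theta> / \<delta> * \<bar>z - w\<bar>"
proof -
  \<comment> \<open>Beyond \<delta> the logarithm has slope at most \<open>1 / \<delta>\<close>; two
    logarithms with weight \<open>\<theta> / 2\<close> give the constant
    \<open>\<theta> / \<delta>\<close>.\<close>
  have ln: "\<bar>ln a - ln b\<bar> \<le> \<bar>a - b\<bar> / \<delta>" if "\<delta> \<le> a" "\<delta> \<le> b" for a b :: real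
  proof -
    have "ln x - ln y \<le> \<bar>x - y\<bar> / \<delta>" if "\<delta> \<le> x" "\<delta> \<le> y" for x y :: real
    proof -
      have "ln x - ln y \<le> (x - y) / y" using that assms(1) by (intro ln_diff_le) auto
      also have "\<dots> \<le> \<bar>x - y\<bar> / y" using that assms(1) by (intro divide_right_mono) auto
      also have "\<dots> \<le> \<bar>x - y\<bar> / \<delta>" using that assms(1) by (intro divide_left_mono) auto
      finally show ?thesis .
    qed
    from this[of a b] this[of b a] that show ?thesis by (simp add: abs_minus_commute)
  qed
  have f: "f_tilde \<theta> y = \<theta> / 2 * (ln (1 + y) - ln (1 - y))" if "\<bar>y\<bar> \<le> 1 - \<delta>" for y
  proof -
    have "0 < 1 + y" "0 < 1 - y" using that assms(1) by linarith+
    then show ?thesis by (simp add: f_tilde_def ln_div)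
  qed
  have "\<delta> \<le> 1 + z" "\<delta> \<le> 1 + w" "\<delta> \<le> 1 - z" "\<delta> \<le> 1 - w" using assms by linarith+
  then have "\<bar>ln (1 + z) - ln (1 + w)\<bar> \<le> \<bar>z - w\<bar> / \<delta>" "\<bar>ln (1 - z) - ln (1 - w)\<bar> \<le> \<bar>z - w\<bar> / \<delta>"
    using ln[of "1 + z" "1 + w"] ln[of "1 - z" "1 - w"] by (simp_all add: abs_minus_commute)
  then have "\<bar>(ln (1 + z) - ln (1 - z)) - (ln (1 + w) - ln (1 - w))\<bar> \<le> \<bar>z - w\<bar> / \<delta> + \<bar>z - w\<bar> / \<delta>"
    by linarith
  from mult_left_mono[OF this, of "\<theta> / 2"] assms(2)
  have "\<theta> / 2 * \<bar>(ln (1 + z) - ln (1 - z)) - (ln (1 + w) - ln (1 - w))\<bar> \<le> \<theta> / \<delta> * \<bar>z - w\<bar>"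
    by (simp add: field_simps)
  then show ?thesis
    unfolding f[OF assms(3)] f[OF assms(4)] right_diff_distrib[symmetric] abs_mult
    using assms(2) by simp
qed

lemma f_tilde_L2:
  assumes "v \<in> L2" "0 < \<delta>" "0 \<le> \<theta>" "AE x in torus. \<bar>v x\<bar> \<le> 1 - \<delta>"
  shows "(\<lambda>x. f_tilde \<theta> (v x)) \<in> L2"
proof (rule L2_bounded)
  show "(\<lambda>x. f_tilde \<theta> (v x)) \<in> borel_measurable torus"
    unfolding f_tilde_def using L2_measurable[OF assms(1)] by measurable
  show "AE x in torus. \<bar>f_tilde \<theta> (v x)\<bar> \<le> \<theta> / \<delta> * (1 - \<delta>)"
    using assms(4)
  proof eventually_elim
    case (elim x)
    have "\<bar>f_tilde \<theta> (v x)\<bar> \<le> \<theta> / \<delta> * \<bar>v x\<bar>"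
      using f_tilde_lipschitz[OF assms(2,3), of "v x" 0] elim by (simp add: f_tilde_def)
    also have "\<dots> \<le> \<theta> / \<delta> * (1 - \<delta>)" using elim assms(2,3) by (intro mult_left_mono) auto
    finally show ?case .
  qed
qed

lemma f_tilde_l2_lipschitz:
  assumes v: "v \<in> L2" and w: "w \<in> L2" and \<delta>: "0 < \<delta>" and \<theta>: "0 \<le> \<theta>"
    and bv: "AE x in torus. \<bar>v x\<bar> \<le> 1 - \<delta>" and bw: "AE x in torus. \<bar>w x\<bar> \<le> 1 - \<delta>"
  shows "norm (abs_l2 (\<lambda>x. f_tilde \<theta> (v x)) - abs_l2 (\<lambda>x. f_tilde \<theta> (w x)))
    \<le> \<theta> / \<delta> * norm (abs_l2 v - abs_l2 w)"
proof -
  note fv = f_tilde_L2[OF v \<delta> \<theta> bv] and fw = f_tilde_L2[OF w \<delta> \<theta> bw]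
  have "(\<integral>x. (f_tilde \<theta> (v x) - f_tilde \<theta> (w x))\<^sup>2 \<partial>torus) \<le> (\<integral>x. (\<theta> / \<delta>)\<^sup>2 * (v x - w x)\<^sup>2 \<partial>torus)"
  proof (rule integral_mono_AE)
    show "integrable torus (\<lambda>x. (f_tilde \<theta> (v x) - f_tilde \<theta> (w x))\<^sup>2)"
      using L2_diff[OF fv fw] by (simp add: L2_def)
    show "integrable torus (\<lambda>x. (\<theta> / \<delta>)\<^sup>2 * (v x - w x)\<^sup>2)"
      using L2_diff[OF v w] by (simp add: L2_def)
    show "AE x in torus. (f_tilde \<theta> (v x) - f_tilde \<theta> (w x))\<^sup>2 \<le> (\<theta> / \<delta>)\<^sup>2 * (v x - w x)\<^sup>2"
      using bv bw
    proof eventually_elim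
      case (elim x)
      from power_mono[OF f_tilde_lipschitz[OF \<delta> \<theta> elim], of 2] show ?case
        by (simp only: power_mult_distrib power2_abs abs_ge_zero)
    qed
  qed
  then have "L2_norm (\<lambda>x. f_tilde \<theta> (v x) - f_tilde \<theta> (w x)) \<le> sqrt ((\<theta> / \<delta>)\<^sup>2 * (\<integral>x. (v x - w x)\<^sup>2 \<partial>torus))"
    unfolding L2_norm_def by simp
  also have "\<dots> = \<theta> / \<delta> * L2_norm (\<lambda>x. v x - w x)"
    using \<delta> \<theta> by (simp add: L2_norm_def real_sqrt_mult)
  finally show ?thesis
    using v w fv fw by (simp add: abs_l2_minus norm_abs_l2 L2_diff)
qed

lemma Linf_norm_bound_AE:
  assumes "Linf_norm f \<le> ereal B"
  shows "AE x in torus. \<bar>f x\<bar> \<le> B"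
proof -
  have "AE x in torus. ereal \<bar>f x\<bar> \<le> Linf_norm f" unfolding Linf_norm_def by (rule esssup_AE)
  then show ?thesis
  proof eventually_elim
    case (elim x)
    then have "ereal \<bar>f x\<bar> \<le> ereal B" using assms by (rule order_trans)
    then show ?case by simp
  qed
qed

section \<open>The error estimate on the torus\<close>

lemma exact_solution_error:
  assumes pos: "0 < \<nu>" "0 < \<theta>" "0 < \<kappa>" and \<delta>: "0 < \<delta>"
    and exact: "exact_solution \<nu> \<theta> \<kappa> u0 u"
    and bu: "\<And>t. 0 \<le> t \<Longrightarrow> AE x in torus. \<bar>u t x\<bar> \<le> 1 - \<delta>"
  obtains C K where "0 \<le> C" "0 \<le> K"
    "\<And>\<tau> U m. 0 < \<tau> \<Longrightarrow> \<tau> \<le> \<nu> / (4 * \<kappa>\<^sup>2) \<Longrightarrow> scheme_solution \<nu> \<theta> \<kappa> \<tau> u0 U \<Longrightarrow>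
      (\<And>n. AE x in torus. \<bar>U n x\<bar> \<le> 1 - \<delta>) \<Longrightarrow>
      norm (abs_l2 (u (real (Suc m) * \<tau>)) - abs_l2 (U (Suc m))) \<le> C * exp (K * (real (Suc m) * \<tau>)) * \<tau>"
proof -
  obtain ut where der: "sobolev_has_time_deriv 1 u ut" and ut: "sobolev_continuous 1 ut"
    and eq: "\<forall>t\<ge>0. \<exists>lap. has_laplacian (u t) lap \<and>
      has_laplacian (\<lambda>x. - \<nu> * lap x - \<kappa> * u t x + f_tilde \<theta> (u t x)) (ut t)"
    using exact unfolding exact_solution_def by blast
  obtain Lf where Lf: "\<And>t. 0 \<le> t \<Longrightarrow> has_laplacian (u t) (Lf t)"
    "\<And>t. 0 \<le> t \<Longrightarrow> has_laplacian (\<lambda>x. - \<nu> * Lf t x - \<kappa> * u t x + f_tilde \<theta> (u t x)) (ut t)"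
    using eq by metis
  note LfL2 = has_laplacian_lap_l2[OF Lf(1)]
  define fu where "fu t = abs_l2 (\<lambda>x. f_tilde \<theta> (u t x))" for t
  have fuL2: "(\<lambda>x. f_tilde \<theta> (u t x)) \<in> L2" if "0 \<le> t" for t
    using f_tilde_L2[OF LfL2(1) \<delta> _ bu] that pos by simp
  have u_der: "((\<lambda>t. abs_l2 (u t)) has_vector_derivative abs_l2 (ut t)) (at t within {0..})" if "0 \<le> t" for t
    by (rule sobolev_time_deriv_l2[OF der LfL2(1) _ that])
      (use ut sobolev_L2 in \<open>auto simp: sobolev_continuous_def\<close>)
  have equ: "lap_l2 ((- \<nu>) *\<^sub>R abs_l2 (Lf t) - \<kappa> *\<^sub>R abs_l2 (u t) + fu t) (abs_l2 (ut t))" if t: "0 \<le> t" for t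
  proof -
    have "(- \<nu>) *\<^sub>R abs_l2 (Lf t) - \<kappa> *\<^sub>R abs_l2 (u t) + fu t
        = abs_l2 (\<lambda>x. - \<nu> * Lf t x - \<kappa> * u t x + f_tilde \<theta> (u t x))"
      using LfL2(1,2)[OF t] fuL2[OF t]
      by (simp only: fu_def abs_l2_plus abs_l2_minus abs_l2_scaleR L2_scale L2_diff)
    with has_laplacian_lap_l2(3)[OF Lf(2)[OF t]] show ?thesis by simp
  qed
  define L where "L = \<theta> / \<delta>"
  have L: "0 \<le> L" using pos \<delta> by (simp add: L_def)
  define K where "K = 3 * (\<kappa> + L)\<^sup>2 / (2 * \<nu>) + (4 * \<kappa>\<^sup>2 / \<nu> + 2 * L\<^sup>2 / \<nu>)"
  show ?thesis
  proof (rule that[of "2 * norm (abs_l2 (ut 0))" K])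
    show "0 \<le> 2 * norm (abs_l2 (ut 0))" by simp
    show "0 \<le> K" using pos by (simp add: K_def)
    fix \<tau> :: real and U :: "nat \<Rightarrow> real \<times> real \<Rightarrow> real" and m :: nat
    assume \<tau>: "0 < \<tau>" "\<tau> \<le> \<nu> / (4 * \<kappa>\<^sup>2)" and sch: "scheme_solution \<nu> \<theta> \<kappa> \<tau> u0 U"
      and bU: "\<And>n. AE x in torus. \<bar>U n x\<bar> \<le> 1 - \<delta>"
    have UL2: "U n \<in> L2" for n using sch unfolding scheme_solution_def by blast
    have "\<forall>n. \<exists>lap bilap nl. has_laplacian (U (Suc n)) lap \<and> has_laplacian lap bilap \<and>
        has_laplacian (\<lambda>x. f_tilde \<theta> (U n x)) nl \<and>
        (AE x in torus. (U (Suc n) x - U n x) / \<tau> = - \<nu> * bilap x - \<kappa> * lap x + nl x)"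
      using sch unfolding scheme_solution_def scheme_step_def by blast
    from choice[OF this] obtain la where "\<forall>n. \<exists>bilap nl. has_laplacian (U (Suc n)) (la n) \<and> has_laplacian (la n) bilap \<and>
        has_laplacian (\<lambda>x. f_tilde \<theta> (U n x)) nl \<and>
        (AE x in torus. (U (Suc n) x - U n x) / \<tau> = - \<nu> * bilap x - \<kappa> * la n x + nl x)" by blast
    from choice[OF this] obtain bl where "\<forall>n. \<exists>nl. has_laplacian (U (Suc n)) (la n) \<and> has_laplacian (la n) (bl n) \<and>
        has_laplacian (\<lambda>x. f_tilde \<theta> (U n x)) nl \<and>
        (AE x in torus. (U (Suc n) x - U n x) / \<tau> = - \<nu> * bl n x - \<kappa> * la n x + nl x)" by blast
    from choice[OF this] obtain nl where la: "\<And>n. has_laplacian (U (Suc n)) (la n)"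
      and bl: "\<And>n. has_laplacian (la n) (bl n)"
      and nl: "\<And>n. has_laplacian (\<lambda>x. f_tilde \<theta> (U n x)) (nl n)"
      and step: "\<And>n. AE x in torus. (U (Suc n) x - U n x) / \<tau> = - \<nu> * bl n x - \<kappa> * la n x + nl n x"
      by blast
    note la' = has_laplacian_lap_l2[OF la] and bl' = has_laplacian_lap_l2[OF bl]
      and nl' = has_laplacian_lap_l2[OF nl]
    \<comment> \<open>The scheme supplies Laplacians of \<open>U (Suc n)\<close> only; the one of
      the initial datum is borrowed from the exact solution at time 0.\<close>
    define LU where "LU n = (case n of 0 \<Rightarrow> abs_l2 (Lf 0) | Suc n \<Rightarrow> abs_l2 (la n))" for n
    have U0: "abs_l2 (U 0) = abs_l2 (u 0)"
    proof -
      have "AE x in torus. U 0 x = u0 x" "AE x in torus. u 0 x = u0 x"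
        using sch exact unfolding scheme_solution_def exact_solution_def by blast+
      then have "AE x in torus. U 0 x = u 0 x" by eventually_elim simp
      then show ?thesis using abs_l2_eq_iff[OF UL2 LfL2(1)] by simp
    qed
    show "norm (abs_l2 (u (real (Suc m) * \<tau>)) - abs_l2 (U (Suc m)))
        \<le> 2 * norm (abs_l2 (ut 0)) * exp (K * (real (Suc m) * \<tau>)) * \<tau>"
      unfolding K_def
    proof (rule lap.scheme_error[where u = "\<lambda>t. abs_l2 (u t)" and u' = "\<lambda>t. abs_l2 (ut t)"
          and Lu = "\<lambda>t. abs_l2 (Lf t)" and fu = fu and U = "\<lambda>n. abs_l2 (U n)" and LU = LU
          and F = "\<lambda>n. abs_l2 (\<lambda>x. f_tilde \<theta> (U n x))"])
      show "0 < \<nu>" "0 < \<tau>" "0 \<le> \<kappa>" "0 \<le> L" "\<tau> \<le> \<nu> / (4 * \<kappa>\<^sup>2)" using pos \<tau> L by auto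
      show "abs_l2 (U 0) = abs_l2 (u 0)" by (rule U0)
      show "LU 0 = abs_l2 (Lf 0)" by (simp add: LU_def)
      show "lap_l2 (abs_l2 (U n)) (LU n)" for n
        using la'(3) LfL2(3)[of 0] by (cases n) (simp_all add: LU_def U0)
      show "lap_l2 ((- \<nu>) *\<^sub>R LU (Suc n) - \<kappa> *\<^sub>R abs_l2 (U (Suc n)) + abs_l2 (\<lambda>x. f_tilde \<theta> (U n x)))
          ((1 / \<tau>) *\<^sub>R (abs_l2 (U (Suc n)) - abs_l2 (U n)))" for n
      proof -
        have "(1 / \<tau>) *\<^sub>R (abs_l2 (U (Suc n)) - abs_l2 (U n)) = abs_l2 (\<lambda>x. 1 / \<tau> * (U (Suc n) x - U n x))"
          using UL2 by (simp only: abs_l2_minus abs_l2_scaleR L2_diff)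
        also have "\<dots> = abs_l2 (\<lambda>x. - \<nu> * bl n x - \<kappa> * la n x + nl n x)"
        proof -
          have "(\<lambda>x. 1 / \<tau> * (U (Suc n) x - U n x)) \<in> L2"
            "(\<lambda>x. - \<nu> * bl n x - \<kappa> * la n x + nl n x) \<in> L2"
            by (intro L2_add L2_diff L2_scale UL2 la'(2) bl'(2) nl'(2))+
          then show ?thesis using step[of n] by (simp add: abs_l2_eq_iff)
        qed
        also have "\<dots> = (- \<nu>) *\<^sub>R abs_l2 (bl n) - \<kappa> *\<^sub>R abs_l2 (la n) + abs_l2 (nl n)"
          using la'(2) bl'(2) nl'(2)
          by (simp only: abs_l2_plus abs_l2_minus abs_l2_scaleR L2_scale L2_diff)
        finally have e: "(1 / \<tau>) *\<^sub>R (abs_l2 (U (Suc n)) - abs_l2 (U n))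
            = (- \<nu>) *\<^sub>R abs_l2 (bl n) - \<kappa> *\<^sub>R abs_l2 (la n) + abs_l2 (nl n)" .
        show ?thesis
          unfolding e LU_def nat.case by (intro lap.add lap.diff lap.scale la'(3) bl'(3) nl'(3))
      qed
      show "norm (fu t - abs_l2 (\<lambda>x. f_tilde \<theta> (U n x))) \<le> L * norm (abs_l2 (u t) - abs_l2 (U n))"
        if "0 \<le> t" for t n
        unfolding fu_def L_def using f_tilde_l2_lipschitz[OF LfL2(1) UL2 \<delta> _ bu bU] that pos by simp
      show "norm (abs_l2 (\<lambda>x. f_tilde \<theta> (U (Suc n) x)) - abs_l2 (\<lambda>x. f_tilde \<theta> (U n x)))
          \<le> L * norm (abs_l2 (U (Suc n)) - abs_l2 (U n))" for n
        unfolding L_def using f_tilde_l2_lipschitz[OF UL2 UL2 \<delta> _ bU bU] pos by simp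
    qed (use u_der LfL2(3) equ in auto)
  qed
qed

lemma exact_solution_L2: "exact_solution \<nu> \<theta> \<kappa> u0 u \<Longrightarrow> 0 \<le> t \<Longrightarrow> u t \<in> L2"
  unfolding exact_solution_def sobolev_continuous_def using sobolev_L2 by blast

lemma exact_solution_separated:
  assumes "exact_solution \<nu> \<theta> \<kappa> u0 u"
  obtains \<delta> where "0 < \<delta>" "\<And>t. 0 \<le> t \<Longrightarrow> AE x in torus. \<bar>u t x\<bar> \<le> 1 - \<delta>"
  using assms Linf_norm_bound_AE unfolding exact_solution_def by metis

lemma AE_bound_mono: "AE x in M. \<bar>f x\<bar> \<le> (a::real) \<Longrightarrow> a \<le> b \<Longrightarrow> AE x in M. \<bar>f x\<bar> \<le> b"
  by (auto elim!: eventually_mono)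

text \<open>Both solutions are the limit of the same scheme as the time step tends to zero.\<close>

lemma exact_solution_unique:
  assumes pos: "0 < \<nu>" "0 < \<theta>" "0 < \<kappa>" and \<delta>: "0 < \<delta>" and \<tau>s: "0 < \<tau>s"
    and u: "exact_solution \<nu> \<theta> \<kappa> u0 u" and v: "exact_solution \<nu> \<theta> \<kappa> u0 v"
    and scheme: "\<And>\<tau>. 0 < \<tau> \<Longrightarrow> \<tau> \<le> \<tau>s \<Longrightarrow>
      \<exists>U. scheme_solution \<nu> \<theta> \<kappa> \<tau> u0 U \<and> (\<forall>n. AE x in torus. \<bar>U n x\<bar> \<le> 1 - \<delta>)"
    and t: "0 < t"
  shows "abs_l2 (u t) = abs_l2 (v t)"
proof -
  obtain \<delta>u where \<delta>u: "0 < \<delta>u" "\<And>t. 0 \<le> t \<Longrightarrow> AE x in torus. \<bar>u t x\<bar> \<le> 1 - \<delta>u"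
    using exact_solution_separated[OF u] by blast
  obtain \<delta>v where \<delta>v: "0 < \<delta>v" "\<And>t. 0 \<le> t \<Longrightarrow> AE x in torus. \<bar>v t x\<bar> \<le> 1 - \<delta>v"
    using exact_solution_separated[OF v] by blast
  \<comment> \<open>One separation for all functions involved lets both error estimates refer to the
    same iterates.\<close>
  define d where "d = min \<delta> (min \<delta>u \<delta>v)"
  have d: "0 < d" "d \<le> \<delta>" "d \<le> \<delta>u" "d \<le> \<delta>v" using \<delta> \<delta>u \<delta>v by (auto simp: d_def)
  obtain C K where C: "\<And>\<tau> U m. 0 < \<tau> \<Longrightarrow> \<tau> \<le> \<nu> / (4 * \<kappa>\<^sup>2) \<Longrightarrow> scheme_solution \<nu> \<theta> \<kappa> \<tau> u0 U \<Longrightarrow>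
      (\<And>n. AE x in torus. \<bar>U n x\<bar> \<le> 1 - d) \<Longrightarrow>
      norm (abs_l2 (u (real (Suc m) * \<tau>)) - abs_l2 (U (Suc m))) \<le> C * exp (K * (real (Suc m) * \<tau>)) * \<tau>"
    by (rule exact_solution_error[OF pos d(1) u AE_bound_mono[OF \<delta>u(2)]]) (use d in auto)
  obtain C' K' where C': "\<And>\<tau> U m. 0 < \<tau> \<Longrightarrow> \<tau> \<le> \<nu> / (4 * \<kappa>\<^sup>2) \<Longrightarrow> scheme_solution \<nu> \<theta> \<kappa> \<tau> u0 U \<Longrightarrow>
      (\<And>n. AE x in torus. \<bar>U n x\<bar> \<le> 1 - d) \<Longrightarrow>
      norm (abs_l2 (v (real (Suc m) * \<tau>)) - abs_l2 (U (Suc m))) \<le> C' * exp (K' * (real (Suc m) * \<tau>)) * \<tau>"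
    by (rule exact_solution_error[OF pos d(1) v AE_bound_mono[OF \<delta>v(2)]]) (use d in auto)
  define M where "M = C * exp (K * t) + C' * exp (K' * t)"
  define \<tau>m where "\<tau>m = min \<tau>s (\<nu> / (4 * \<kappa>\<^sup>2))"
  have \<tau>m: "0 < \<tau>m" using \<tau>s pos by (simp add: \<tau>m_def)
  have lim: "(\<lambda>m. t / real (Suc m)) \<longlonglongrightarrow> 0"
    using LIMSEQ_Suc[OF lim_const_over_n[of t]] by simp
  have "norm (abs_l2 (u t) - abs_l2 (v t)) \<le> M * (t / real (Suc m))" if m: "t / real (Suc m) \<le> \<tau>m" for m
  proof -
    \<comment> \<open>The time step divides \<open>t\<close>, so both solutions at time
      \<open>t\<close> are compared with the same iterate \<open>U (Suc m)\<close>.\<close>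
    define \<tau> where "\<tau> = t / real (Suc m)"
    have \<tau>: "0 < \<tau>" "\<tau> \<le> \<tau>s" "\<tau> \<le> \<nu> / (4 * \<kappa>\<^sup>2)" "real (Suc m) * \<tau> = t"
      using t m by (auto simp: \<tau>_def \<tau>m_def)
    obtain U where U: "scheme_solution \<nu> \<theta> \<kappa> \<tau> u0 U" "\<And>n. AE x in torus. \<bar>U n x\<bar> \<le> 1 - \<delta>"
      using scheme[OF \<tau>(1,2)] by blast
    have bU: "AE x in torus. \<bar>U n x\<bar> \<le> 1 - d" for n
      using AE_bound_mono[OF U(2)] d by simp
    have "norm (abs_l2 (u t) - abs_l2 (v t))
        \<le> norm (abs_l2 (u t) - abs_l2 (U (Suc m))) + norm (abs_l2 (v t) - abs_l2 (U (Suc m)))"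
      using norm_triangle_ineq4[of "abs_l2 (u t) - abs_l2 (U (Suc m))" "abs_l2 (v t) - abs_l2 (U (Suc m))"] by simp
    also have "\<dots> \<le> C * exp (K * t) * \<tau> + C' * exp (K' * t) * \<tau>"
      using C[OF \<tau>(1,3) U(1) bU, of m] C'[OF \<tau>(1,3) U(1) bU, of m] unfolding \<tau>(4) by linarith
    finally show ?thesis by (simp add: M_def \<tau>_def distrib_right add_divide_distrib)
  qed
  moreover have "eventually (\<lambda>m. t / real (Suc m) < \<tau>m) sequentially"
    using order_tendstoD(2)[OF lim \<tau>m] .
  ultimately have "eventually (\<lambda>m. norm (abs_l2 (u t) - abs_l2 (v t)) \<le> M * (t / real (Suc m))) sequentially"
    by (auto elim!: eventually_mono)
  moreover have "(\<lambda>m. M * (t / real (Suc m))) \<longlonglongrightarrow> 0"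
    using tendsto_mult_right_zero[OF lim] .
  ultimately have "norm (abs_l2 (u t) - abs_l2 (v t)) \<le> 0"
    by (intro tendsto_lowerbound[of "\<lambda>m. M * (t / real (Suc m))" 0 sequentially]) auto
  then show ?thesis by simp
qed

lemma L2_norm_le_bound:
  assumes "f \<in> L2" "AE x in torus. \<bar>f x\<bar> \<le> B" "0 \<le> B"
  shows "L2_norm f \<le> 2 * pi * B"
proof -
  have "(\<integral>x. (f x)\<^sup>2 \<partial>torus) \<le> (\<integral>x. B\<^sup>2 \<partial>torus)"
  proof (rule integral_mono_AE)
    show "integrable torus (\<lambda>x. (f x)\<^sup>2)" using assms(1) by (simp add: L2_def)
    show "AE x in torus. (f x)\<^sup>2 \<le> B\<^sup>2"
      using assms(2)
    proof eventually_elim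
      case (elim x)
      from power_mono[OF elim, of 2] show ?case by simp
    qed
  qed simp
  also have "\<dots> = (2 * pi * B)\<^sup>2"
    by (simp add: measure_def emeasure_torus power_mult_distrib)
  finally have "L2_norm f \<le> sqrt ((2 * pi * B)\<^sup>2)" unfolding L2_norm_def by (rule real_sqrt_le_mono)
  with assms(3) show ?thesis by simp
qed

theorem theorem1p2:
  fixes \<nu> \<theta> \<theta>\<^sub>c \<delta>0 :: real and u0 :: "real \<times> real \<Rightarrow> real"
  assumes "0 < \<nu>" and "0 < \<theta>" and "\<theta> < \<theta>\<^sub>c"
    and "0 < \<delta>0" and "\<delta>0 < 1"
    and "u0 \<in> sobolev 5" and "Linf_norm u0 \<le> ereal (1 - \<delta>0)"
  shows "\<exists>C1>0. \<exists>C2>0. \<forall>\<tau>0 \<tau> U u.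
           time_step_threshold (sobolev_norm 5 u0) \<delta>0 \<nu> \<theta> \<theta>\<^sub>c \<tau>0 \<longrightarrow>
           0 < \<tau> \<longrightarrow> \<tau> \<le> min \<tau>0 (\<nu> / (4 * \<theta>\<^sub>c\<^sup>2)) \<longrightarrow>
           scheme_solution \<nu> \<theta> \<theta>\<^sub>c \<tau> u0 U \<longrightarrow>
           exact_solution \<nu> \<theta> \<theta>\<^sub>c u0 u \<longrightarrow>
           (\<forall>m\<ge>1. L2_norm (\<lambda>x. u (real m * \<tau>) x - U m x)
                    \<le> C1 * exp (C2 * (real m * \<tau>)) * \<tau>)"
proof (cases "\<exists>\<tau>s us. time_step_threshold (sobolev_norm 5 u0) \<delta>0 \<nu> \<theta> \<theta>\<^sub>c \<tau>s \<and> exact_solution \<nu> \<theta> \<theta>\<^sub>c u0 us")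
  \<comment> \<open>Without a threshold or without an exact solution the implication is vacuous, and
    any positive constants will do.\<close>
  case False
  then show ?thesis by (intro exI[of _ "1::real"] conjI) auto
next
  case True
  have pos: "0 < \<nu>" "0 < \<theta>" "0 < \<theta>\<^sub>c" using assms by auto
  obtain \<tau>s us where thr: "time_step_threshold (sobolev_norm 5 u0) \<delta>0 \<nu> \<theta> \<theta>\<^sub>c \<tau>s"
    and us: "exact_solution \<nu> \<theta> \<theta>\<^sub>c u0 us" using True by blast
  have \<tau>s: "0 < \<tau>s" using thr by (simp add: time_step_threshold_def)
  \<comment> \<open>The separation \<open>\<delta>1\<close> provided by \<open>time_step_threshold\<close> depends on the threshold, so one threshold
    \<open>\<tau>s\<close> is fixed; for time steps above it the trivial bound on the error is linear in \<open>\<tau>\<close>.\<close>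
  obtain \<delta>1 where \<delta>1: "0 < \<delta>1"
    and ex: "\<And>\<tau>. 0 < \<tau> \<Longrightarrow> \<tau> \<le> \<tau>s \<Longrightarrow> \<exists>V. scheme_solution \<nu> \<theta> \<theta>\<^sub>c \<tau> u0 V"
    and sep: "\<And>\<tau> V n. 0 < \<tau> \<Longrightarrow> \<tau> \<le> \<tau>s \<Longrightarrow> scheme_solution \<nu> \<theta> \<theta>\<^sub>c \<tau> u0 V \<Longrightarrow> n \<ge> 1 \<Longrightarrow>
      Linf_norm (V n) \<le> ereal (1 - \<delta>1)"
    using thr assms(6,7) unfolding time_step_threshold_def by blast
  obtain \<delta>s where \<delta>s: "0 < \<delta>s" "\<And>t. 0 \<le> t \<Longrightarrow> AE x in torus. \<bar>us t x\<bar> \<le> 1 - \<delta>s"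
    using exact_solution_separated[OF us] by blast
  define d where "d = min \<delta>0 (min \<delta>1 \<delta>s)"
  have d: "0 < d" "d \<le> \<delta>0" "d \<le> \<delta>1" "d \<le> \<delta>s" using assms \<delta>1 \<delta>s by (auto simp: d_def)
  have bV: "AE x in torus. \<bar>V n x\<bar> \<le> 1 - d"
    if \<tau>: "0 < \<tau>" "\<tau> \<le> \<tau>s" and V: "scheme_solution \<nu> \<theta> \<theta>\<^sub>c \<tau> u0 V" for \<tau> V n
  proof (cases "n = 0")
    \<comment> \<open>The threshold controls iterates from index 1 on; at index 0 the separation is
      that of the initial datum.\<close>
    case True
    have "AE x in torus. V 0 x = u0 x" using V unfolding scheme_solution_def by blast
    moreover have "AE x in torus. \<bar>u0 x\<bar> \<le> 1 - \<delta>0" by (rule Linf_norm_bound_AE[OF assms(7)])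
    ultimately have "AE x in torus. \<bar>V 0 x\<bar> \<le> 1 - \<delta>0" by eventually_elim simp
    then show ?thesis using True d by (auto intro: AE_bound_mono)
  next
    case False
    then have "AE x in torus. \<bar>V n x\<bar> \<le> 1 - \<delta>1"
      by (intro Linf_norm_bound_AE sep[OF \<tau> V]) simp
    then show ?thesis using d by (auto intro: AE_bound_mono)
  qed
  obtain C K where C: "0 \<le> C" "0 \<le> K" and
    err: "\<And>\<tau> U m. 0 < \<tau> \<Longrightarrow> \<tau> \<le> \<nu> / (4 * \<theta>\<^sub>c\<^sup>2) \<Longrightarrow> scheme_solution \<nu> \<theta> \<theta>\<^sub>c \<tau> u0 U \<Longrightarrow>
      (\<And>n. AE x in torus. \<bar>U n x\<bar> \<le> 1 - d) \<Longrightarrow>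
      norm (abs_l2 (us (real (Suc m) * \<tau>)) - abs_l2 (U (Suc m))) \<le> C * exp (K * (real (Suc m) * \<tau>)) * \<tau>"
    by (rule exact_solution_error[OF pos d(1) us AE_bound_mono[OF \<delta>s(2)]]) (use d in auto)
  \<comment> \<open>In the second summand \<open>4 * pi\<close> bounds the L2 norm of a difference
    of two functions with values between -1 and 1: the torus has measure
    \<open>4 * pi\<^sup>2\<close>.\<close>
  define C1 where "C1 = C + 4 * pi / \<tau>s"
  have C1: "0 < C1" "C \<le> C1" "4 * pi / \<tau>s \<le> C1"
    using C \<tau>s by (auto simp: C1_def add_nonneg_pos)
  have main: "L2_norm (\<lambda>x. u (real m * \<tau>) x - U m x) \<le> C1 * exp ((K + 1) * (real m * \<tau>)) * \<tau>"
    if \<tau>: "0 < \<tau>" "\<tau> \<le> \<nu> / (4 * \<theta>\<^sub>c\<^sup>2)" and U: "scheme_solution \<nu> \<theta> \<theta>\<^sub>c \<tau> u0 U"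
      and u: "exact_solution \<nu> \<theta> \<theta>\<^sub>c u0 u" and m: "m \<ge> 1" for \<tau> U u m
  proof -
    have t: "0 < real m * \<tau>" using m \<tau> by simp
    have UL2: "U m \<in> L2" using U unfolding scheme_solution_def by blast
    have uL2: "u (real m * \<tau>) \<in> L2" using exact_solution_L2[OF u] t by simp
    show ?thesis
    proof (cases "\<tau> \<le> \<tau>s")
      case True
      \<comment> \<open>\<open>C\<close> and \<open>K\<close> belong to the selected solution
        \<open>us\<close>; uniqueness transfers its estimate to \<open>u\<close>.\<close>
      have "abs_l2 (u (real m * \<tau>)) = abs_l2 (us (real m * \<tau>))"
        using exact_solution_unique[OF pos d(1) \<tau>s u us _ t] ex bV by blast
      moreover have "L2_norm (\<lambda>x. u (real m * \<tau>) x - U m x) = norm (abs_l2 (u (real m * \<tau>)) - abs_l2 (U m))"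
        using uL2 UL2 by (simp add: abs_l2_minus norm_abs_l2 L2_diff)
      ultimately have "L2_norm (\<lambda>x. u (real m * \<tau>) x - U m x) = norm (abs_l2 (us (real m * \<tau>)) - abs_l2 (U m))"
        by simp
      also have "\<dots> \<le> C * exp (K * (real m * \<tau>)) * \<tau>"
        using err[OF \<tau> U bV[OF \<tau>(1) True U], of "m - 1"] m by simp
      also have "\<dots> \<le> C1 * exp ((K + 1) * (real m * \<tau>)) * \<tau>"
        using C C1 \<tau> t mult_right_mono[of K "K + 1" "real m * \<tau>"] by (intro mult_mono) auto
      finally show ?thesis .
    next
      case False
      obtain \<delta>u where "0 < \<delta>u" "AE x in torus. \<bar>u (real m * \<tau>) x\<bar> \<le> 1 - \<delta>u"
        using exact_solution_separated[OF u] t by (metis less_imp_le)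
      moreover have "AE x in torus. U m x \<in> {-1<..<1}" using U unfolding scheme_solution_def by blast
      ultimately have "AE x in torus. \<bar>u (real m * \<tau>) x - U m x\<bar> \<le> 2"
        by (auto elim!: eventually_elim2)
      then have "L2_norm (\<lambda>x. u (real m * \<tau>) x - U m x) \<le> 2 * pi * 2"
        by (intro L2_norm_le_bound L2_diff uL2 UL2) auto
      also have "\<dots> \<le> 4 * pi / \<tau>s * \<tau>" using False \<tau>s by (simp add: field_simps)
      also have "\<dots> \<le> C1 * 1 * \<tau>"
        unfolding mult_1_right using C1 \<tau> by (intro mult_right_mono) auto
      also have "\<dots> \<le> C1 * exp ((K + 1) * (real m * \<tau>)) * \<tau>"
        using C C1 \<tau> t by (intro mult_right_mono mult_left_mono) auto
      finally show ?thesis .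
    qed
  qed
  show ?thesis
    \<comment> \<open>Only \<open>0 \<le> K\<close> is known, so \<open>K + 1\<close> is taken as
      the positive second constant.\<close>
    by (rule exI[of _ C1], intro conjI C1, rule exI[of _ "K + 1"]) (use C main in auto)
qed

end
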